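(* Let $X$ be a $\mathbb{Z}_2$-space, let $x_0\in X$ be a $\mathbb{Z}_2$-fixed point, and let $D,d\geq 0$ be integers. Then there is an isomorphism $$\pi_D\left(\left(\Omega^{d+1}X\right)^{\mathbb{Z}_2}\right)\cong\pi_{D+1}\left(\Omega^dX,\left(\Omega^dX\right)^{\mathbb{Z}_2}\right),$$ where the base points on both sides are the constant maps to $x_0$. (Isomorphism means an isomorphism of groups for $D\geq 1$ and a bijection of sets for $D=0$.)
   Context: A $\mathbb{Z}_2$-space is a topological space with a continuous action of $\mathbb{Z}_2=\{1,g\}$; $Y^{\mathbb{Z}_2}$ denotes the fixed point set of a $\mathbb{Z}_2$-space $Y$. Let $I=[-\pi,\pi]$. For $d\ge 0$, $\Omega^dX$ is the $d$-fold iterated loop space of $(X,x_0)$: the space of all continuous maps $I^d\to X$ sending $\partial I^d$ to $x_0$ (with the compact-open topology; $\Omega^0X=X$). The cube $I^d$ carries the action $g\mathbf{k}=-\mathbf{k}$, and $\mathbb{Z}_2$ acts on $\Omega^dX$ by $(g\cdot f)(\mathbf{k})=g\,f(-\mathbf{k})$ (for $d=0$ this is the given action on $X$). Thus $(\Omega^dX)^{\mathbb{Z}_2}$ is the subspace of $\mathbb{Z}_2$-equivariant maps in $\Omega^dX$. For a based pair $(Y,B,y_0)$ and $k\ge1$, $\pi_k(Y,B)$ is the relative homotopy set of homotopy classes of maps of triples $(I^k,\partial I^k,J^{k-1})\to(Y,B,y_0)$, where $J^{k-1}=\partial I^{k-1}\times I\cup I^{k-1}\times\{\pi\}$ (and $J^0=\{\pi\}$);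 for $k\ge 2$ it is a group under concatenation in the first coordinate. $\pi_0$ denotes the set of path components. *)

theory Defs
  imports "HOL-Analysis.Analysis" "HOL-Algebra.Group"
begin

section \<open>Spaces with an involution\<close>

text \<open>An action of \<open>\<int>\<^sub>2 = {1, g}\<close> is given by the action of its generator \<open>g\<close>.\<close>

definition Z2_space :: "'a topology \<Rightarrow> ('a \<Rightarrow> 'a) \<Rightarrow> bool" where
  "Z2_space X g \<longleftrightarrow> continuous_map X X g \<and> (\<forall>x\<in>topspace X. g (g x) = x)"

definition Z2_fixed :: "'a topology \<Rightarrow> ('a \<Rightarrow> 'a) \<Rightarrow> 'a set" where
  "Z2_fixed X g = {x \<in> topspace X. g x = x}"


section \<open>Mapping spaces\<close>

text \<open>
  A continuous map is represented by the function that is \<^const>\<open>undefined\<close> outside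
  the domain, so that equality of maps is equality of functions.
\<close>

definition cmaps :: "'a topology \<Rightarrow> 'b topology \<Rightarrow> ('a \<Rightarrow> 'b) set" where
  "cmaps X Y = {f \<in> extensional (topspace X). continuous_map X Y f}"

definition compact_open :: "'a topology \<Rightarrow> 'b topology \<Rightarrow> ('a \<Rightarrow> 'b) topology" where
  "compact_open X Y = topology_generated_by
     {{f \<in> cmaps X Y. f ` K \<subseteq> U} |K U. compactin X K \<and> openin Y U}"

lemma topspace_compact_open [simp]: "topspace (compact_open X Y) = cmaps X Y"
proof -
  have "cmaps X Y \<in> {{f \<in> cmaps X Y. f ` K \<subseteq> U} |K U. compactin X K \<and> openin Y U}"
    by (force intro: exI[of _ "{}"] exI[of _ "topspace Y"])
  then show ?thesis
    unfolding compact_open_def topology_generated_by_topspace by blast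
qed


section \<open>Cubes\<close>

text \<open>
  \<open>I\<^sup>n\<close> with \<open>I = [-\<pi>, \<pi>]\<close>; the \<open>n\<close> coordinates are indexed by \<open>0, \<dots>, n - 1\<close>.
  The only point of \<open>I\<^sup>0\<close> is \<open>\<lambda>_. undefined\<close>, and its boundary is empty.
\<close>

definition cube :: "nat \<Rightarrow> (nat \<Rightarrow> real) topology" where
  "cube n = product_topology (\<lambda>_. top_of_set {-pi..pi}) {..<n}"

definition cube_boundary :: "nat \<Rightarrow> (nat \<Rightarrow> real) set" where
  "cube_boundary n = {s \<in> topspace (cube n). \<exists>i<n. s i = -pi \<or> s i = pi}"

text \<open>\<open>J\<^sup>n\<^sup>-\<^sup>1 = \<partial>I\<^sup>n\<^sup>-\<^sup>1 \<times> I \<union> I\<^sup>n\<^sup>-\<^sup>1 \<times> {\<pi>}\<close> inside \<open>I\<^sup>n\<close>, for \<open>n \<ge> 1\<close>.\<close>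

definition cube_J :: "nat \<Rightarrow> (nat \<Rightarrow> real) set" where
  "cube_J n = {s \<in> topspace (cube n).
     (\<exists>i<n - 1. s i = -pi \<or> s i = pi) \<or> s (n - 1) = pi}"

definition cube_neg :: "nat \<Rightarrow> (nat \<Rightarrow> real) \<Rightarrow> nat \<Rightarrow> real" where
  "cube_neg n s = (\<lambda>i\<in>{..<n}. - s i)"

definition cube_const :: "nat \<Rightarrow> 'b \<Rightarrow> (nat \<Rightarrow> real) \<Rightarrow> 'b" where
  "cube_const n y = (\<lambda>s\<in>topspace (cube n). y)"

definition cube_concat ::
    "nat \<Rightarrow> ((nat \<Rightarrow> real) \<Rightarrow> 'b) \<Rightarrow> ((nat \<Rightarrow> real) \<Rightarrow> 'b) \<Rightarrow> (nat \<Rightarrow> real) \<Rightarrow> 'b" where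
  "cube_concat n f h = (\<lambda>s\<in>topspace (cube n).
     if s 0 \<le> 0 then f (s(0 := 2 * s 0 + pi)) else h (s(0 := 2 * s 0 - pi)))"


section \<open>Iterated loop spaces\<close>

definition loop_space :: "nat \<Rightarrow> 'a topology \<Rightarrow> 'a \<Rightarrow> ((nat \<Rightarrow> real) \<Rightarrow> 'a) topology" where
  "loop_space d X x0 =
     subtopology (compact_open (cube d) X) {f. \<forall>s\<in>cube_boundary d. f s = x0}"

definition loop_action ::
    "nat \<Rightarrow> ('a \<Rightarrow> 'a) \<Rightarrow> ((nat \<Rightarrow> real) \<Rightarrow> 'a) \<Rightarrow> (nat \<Rightarrow> real) \<Rightarrow> 'a" where
  "loop_action d g f = (\<lambda>s\<in>topspace (cube d). g (f (cube_neg d s)))"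

definition loop_fixed :: "nat \<Rightarrow> 'a topology \<Rightarrow> ('a \<Rightarrow> 'a) \<Rightarrow> 'a \<Rightarrow> ((nat \<Rightarrow> real) \<Rightarrow> 'a) set" where
  "loop_fixed d X g x0 = Z2_fixed (loop_space d X x0) (loop_action d g)"

definition loop_fixed_space ::
    "nat \<Rightarrow> 'a topology \<Rightarrow> ('a \<Rightarrow> 'a) \<Rightarrow> 'a \<Rightarrow> ((nat \<Rightarrow> real) \<Rightarrow> 'a) topology" where
  "loop_fixed_space d X g x0 = subtopology (loop_space d X x0) (loop_fixed d X g x0)"

text \<open>
  \<open>\<Omega>\<^sup>0X\<close> consists of maps from a point rather than points of \<open>X\<close>; evaluation
  identifies it with \<open>X\<close>, compatibly with the actions.
\<close>

lemma topspace_cube_0: "topspace (cube 0) = {\<lambda>_. undefined}"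
  by (simp add: cube_def)

lemma loop_space_0: "homeomorphic_map (loop_space 0 X x0) X (\<lambda>f. f (\<lambda>_. undefined))"
proof -
  let ?p = "(\<lambda>_. undefined) :: nat \<Rightarrow> real"
  have ls: "loop_space 0 X x0 = compact_open (cube 0) X"
    by (simp add: loop_space_def cube_boundary_def)
  have cm: "cmaps (cube 0) X = {f \<in> extensional {?p}. f ?p \<in> topspace X}"
  proof -
    have "continuous_map (cube 0) X f" if "f ?p \<in> topspace X" for f
    proof -
      have "continuous_map (cube 0) X (\<lambda>_. f ?p)" using that by simp
      then show ?thesis
        by (rule continuous_map_eq) (simp add: topspace_cube_0)
    qed
    then show ?thesis
      unfolding cmaps_def by (auto simp: topspace_cube_0 dest: continuous_map_funspace)
  qed
  have "homeomorphic_maps (compact_open (cube 0) X) X (\<lambda>f. f ?p) (\<lambda>x. \<lambda>s\<in>{?p}. x)"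
    unfolding homeomorphic_maps_def
  proof (intro conjI ballI)
    show "continuous_map (compact_open (cube 0) X) X (\<lambda>f. f ?p)"
      unfolding continuous_map_def
    proof (intro conjI allI impI)
      show "(\<lambda>f. f ?p) \<in> topspace (compact_open (cube 0) X) \<rightarrow> topspace X"
        by (auto simp: cm)
      fix U assume U: "openin X U"
      have "compactin (cube 0) {?p}" by (simp add: topspace_cube_0)
      then have "openin (compact_open (cube 0) X) {f \<in> cmaps (cube 0) X. f ` {?p} \<subseteq> U}"
        unfolding compact_open_def using U by (intro topology_generated_by_Basis) blast
      then show "openin (compact_open (cube 0) X)
          {f \<in> topspace (compact_open (cube 0) X). f ?p \<in> U}"
        by simp
    qed
    show "continuous_map X (compact_open (cube 0) X) (\<lambda>x. \<lambda>s\<in>{?p}. x)"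
      unfolding compact_open_def
    proof (rule continuous_on_generated_topo)
      have "\<Union> {{f \<in> cmaps (cube 0) X. f ` K \<subseteq> U} |K U. compactin (cube 0) K \<and> openin X U}
          = cmaps (cube 0) X"
        using topspace_compact_open[of "cube 0" X]
        unfolding compact_open_def topology_generated_by_topspace .
      then show "(\<lambda>x. \<lambda>s\<in>{?p}. x) ` topspace X \<subseteq>
          \<Union> {{f \<in> cmaps (cube 0) X. f ` K \<subseteq> U} |K U. compactin (cube 0) K \<and> openin X U}"
        by (auto simp: cm)
    next
      fix W assume "W \<in> {{f \<in> cmaps (cube 0) X. f ` K \<subseteq> U} |K U. compactin (cube 0) K \<and> openin X U}"
      then obtain K U where W: "W = {f \<in> cmaps (cube 0) X. f ` K \<subseteq> U}"
          "compactin (cube 0) K" "openin X U" by blast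
      have "K \<subseteq> {?p}"
        using W(2) compactin_subset_topspace by (fastforce simp: topspace_cube_0)
      then consider "K = {}" | "K = {?p}" by blast
      then show "openin X ((\<lambda>x. \<lambda>s\<in>{?p}. x) -` W \<inter> topspace X)"
      proof cases
        case 1
        then have "(\<lambda>x. \<lambda>s\<in>{?p}. x) -` W \<inter> topspace X = topspace X"
          by (auto simp: W(1) cm)
        then show ?thesis by (metis openin_topspace)
      next
        case 2
        then have "(\<lambda>x. \<lambda>s\<in>{?p}. x) -` W \<inter> topspace X = U"
          using openin_subset[OF W(3)] by (auto simp: W(1) cm)
        then show ?thesis using W(3) by simp
      qed
    qed
  next
    fix f assume "f \<in> topspace (compact_open (cube 0) X)"
    then have "f \<in> extensional {?p}" by (simp add: cm)
    moreover have "(\<lambda>s\<in>{?p}. f ?p) = restrict f {?p}" by (rule restrict_ext) simp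
    ultimately show "(\<lambda>s\<in>{?p}. f ?p) = f" by (simp only: extensional_restrict)
  qed auto
  then show ?thesis
    using ls homeomorphic_maps_map by metis
qed

lemma loop_action_0: "loop_action 0 g f (\<lambda>_. undefined) = g (f (\<lambda>_. undefined))"
  by (simp add: loop_action_def topspace_cube_0 cube_neg_def restrict_def)


section \<open>Homotopy groups\<close>

text \<open>
  Maps \<open>I\<^sup>n \<rightarrow> Y\<close> satisfying a boundary condition \<open>P\<close>, up to homotopy through such maps.
\<close>

definition cube_homotopy ::
    "(((nat \<Rightarrow> real) \<Rightarrow> 'b) \<Rightarrow> bool) \<Rightarrow> nat \<Rightarrow> 'b topology \<Rightarrow> ((nat \<Rightarrow> real) \<Rightarrow> 'b) rel" where
  "cube_homotopy P n Y =
     {(f, h). f \<in> cmaps (cube n) Y \<and> h \<in> cmaps (cube n) Y \<and> homotopic_with P (cube n) Y f h}"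

definition cube_classes ::
    "(((nat \<Rightarrow> real) \<Rightarrow> 'b) \<Rightarrow> bool) \<Rightarrow> nat \<Rightarrow> 'b topology \<Rightarrow> ((nat \<Rightarrow> real) \<Rightarrow> 'b) set set" where
  "cube_classes P n Y = {f \<in> cmaps (cube n) Y. P f} // cube_homotopy P n Y"

definition cube_group ::
    "(((nat \<Rightarrow> real) \<Rightarrow> 'b) \<Rightarrow> bool) \<Rightarrow> nat \<Rightarrow> 'b topology \<Rightarrow> 'b \<Rightarrow> ((nat \<Rightarrow> real) \<Rightarrow> 'b) set monoid" where
  "cube_group P n Y y0 =
     \<lparr>carrier = cube_classes P n Y,
      mult = (\<lambda>A B. \<Union>f\<in>A. \<Union>h\<in>B. cube_homotopy P n Y `` {cube_concat n f h}),
      one = cube_homotopy P n Y `` {cube_const n y0}\<rparr>"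

definition abs_cond :: "nat \<Rightarrow> 'b \<Rightarrow> ((nat \<Rightarrow> real) \<Rightarrow> 'b) \<Rightarrow> bool" where
  "abs_cond n y0 f \<longleftrightarrow> (\<forall>s\<in>cube_boundary n. f s = y0)"

definition rel_cond :: "nat \<Rightarrow> 'b set \<Rightarrow> 'b \<Rightarrow> ((nat \<Rightarrow> real) \<Rightarrow> 'b) \<Rightarrow> bool" where
  "rel_cond n B y0 f \<longleftrightarrow> (\<forall>s\<in>cube_boundary n. f s \<in> B) \<and> (\<forall>s\<in>cube_J n. f s = y0)"

text \<open>
  \<open>\<pi>\<^sub>n(Y, y\<^sub>0)\<close> for \<open>n \<ge> 1\<close> (for \<open>\<pi>\<^sub>0\<close> see \<^const>\<open>path_components_of\<close>), the set
  \<open>\<pi>\<^sub>n(Y, B, y\<^sub>0)\<close> for \<open>n \<ge> 1\<close>, and the group structure on the latter for \<open>n \<ge> 2\<close>.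
\<close>

definition homotopy_group ::
    "nat \<Rightarrow> 'b topology \<Rightarrow> 'b \<Rightarrow> ((nat \<Rightarrow> real) \<Rightarrow> 'b) set monoid" where
  "homotopy_group n Y y0 = cube_group (abs_cond n y0) n Y y0"

definition rel_homotopy_set ::
    "nat \<Rightarrow> 'b topology \<Rightarrow> 'b set \<Rightarrow> 'b \<Rightarrow> ((nat \<Rightarrow> real) \<Rightarrow> 'b) set set" where
  "rel_homotopy_set n Y B y0 = cube_classes (rel_cond n B y0) n Y"

definition rel_homotopy_group ::
    "nat \<Rightarrow> 'b topology \<Rightarrow> 'b set \<Rightarrow> 'b \<Rightarrow> ((nat \<Rightarrow> real) \<Rightarrow> 'b) set monoid" where
  "rel_homotopy_group n Y B y0 = cube_group (rel_cond n B y0) n Y y0"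

end

theory Submission
  imports Defs
begin

text \<open>
  An equivariant loop \<open>I\<^sup>d\<^sup>+\<^sup>1 \<rightarrow> X\<close> is determined by its restriction to the half cube on which the last
  coordinate is nonnegative. Rescaling that coordinate to \<open>I\<close>, the half is a path in \<open>\<Omega>\<^sup>dX\<close> from an
  equivariant loop (at \<open>0\<close>) to the constant loop (at \<open>\<pi>\<close>), and every such path arises, because the
  equivariant extension to the other half agrees with it on the middle slice. In families over \<open>I\<^sup>D\<close>
  this is a bijection between the maps representing the two sides, with the path parameter as the last
  coordinate of \<open>I\<^sup>D\<^sup>+\<^sup>1\<close>. By the exponential law it preserves and reflects homotopies, and it commutes
  strictly with concatenation, which takes place in another coordinate. Hence the group axioms need to
  be checked only for the absolute homotopy group.
\<close>

section \<open>The exponential law\<close>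

text \<open>The two constructions are made inverse to each other as functions, not merely up to
  homotopy: maps are extensional, so agreement on the cubes is equality. The path parameter has to
  be the last coordinate because \<open>cube_J\<close> singles out that one, whereas concatenation
  acts on coordinate \<open>0\<close>. For D \<ge> 1 these are different coordinates of the
  (D+1)-cube; for D = 0 they coincide, only a bijection of sets is claimed, and path components are
  first rewritten as classes of maps of the 0-cube. Relative concatenation is never studied
  directly. Even the fact that it respects homotopy is obtained by going to the absolute side and
  back. Continuity of both constructions is proved with an extra parameter space. Taking it to be
  [0,1] treats homotopies, and a single map is then covered by its constant homotopy.\<close>

lemma openin_compact_open:
  assumes "compactin K C" "openin X U"
  shows "openin (compact_open K X) {f \<in> cmaps K X. f ` C \<subseteq> U}"
  unfolding compact_open_def using assms by (intro topology_generated_by_Basis) blast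

text \<open>Only subbasic sets have to be tested. If \<open>h z\<close> maps the compact set
  \<open>C\<close> into \<open>U\<close>, the tube lemma thickens \<open>{z} \<times> C\<close> to a
  product inside the preimage of \<open>U\<close>, so all nearby slices map \<open>C\<close> into
  \<open>U\<close> too. The assumption \<open>ext\<close> is there because points of
  \<open>compact_open K X\<close> are extensional functions, which the uncurried map cannot
  see.\<close>

lemma continuous_map_into_compact_open:
  assumes H: "continuous_map (prod_topology Z K) X (\<lambda>(z, k). h z k)"
    and ext: "\<And>z. z \<in> topspace Z \<Longrightarrow> h z \<in> extensional (topspace K)"
  shows "continuous_map Z (compact_open K X) h"
proof -
  have hz: "h z \<in> cmaps K X" if "z \<in> topspace Z" for z
  proof -
    have "continuous_map K (prod_topology Z K) (Pair z)"
      using that by (simp add: continuous_map_pairwise o_def)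
    then have "continuous_map K X ((\<lambda>(z, k). h z k) \<circ> Pair z)"
      using H by (rule continuous_map_compose)
    then show ?thesis using ext that by (simp add: cmaps_def o_def)
  qed
  show ?thesis
    unfolding compact_open_def
  proof (rule continuous_on_generated_topo)
    show "h ` topspace Z \<subseteq> \<Union> {{f \<in> cmaps K X. f ` C \<subseteq> U} |C U. compactin K C \<and> openin X U}"
      using topspace_compact_open[of K X] hz
      unfolding compact_open_def topology_generated_by_topspace by (simp add: image_subset_iff)
  next
    fix W assume "W \<in> {{f \<in> cmaps K X. f ` C \<subseteq> U} |C U. compactin K C \<and> openin X U}"
    then obtain C U where W: "W = {f \<in> cmaps K X. f ` C \<subseteq> U}"
      and C: "compactin K C" and U: "openin X U" by blast
    let ?O = "{p \<in> topspace (prod_topology Z K). (\<lambda>(z, k). h z k) p \<in> U}"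
    have O: "openin (prod_topology Z K) ?O"
      using H U by (rule openin_continuous_map_preimage)
    show "openin Z (h -` W \<inter> topspace Z)"
    proof (subst openin_subopen, intro ballI)
      fix z assume z: "z \<in> h -` W \<inter> topspace Z"
      then have "{z} \<times> C \<subseteq> ?O"
        using compactin_subset_topspace[OF C] W by auto
      moreover have "compactin Z {z}" using IntD2[OF z] unfolding compactin_sing .
      ultimately obtain A B where AB: "openin Z A" "openin K B" "{z} \<subseteq> A" "C \<subseteq> B" "A \<times> B \<subseteq> ?O"
        using Wallace_theorem_prod_topology[OF _ C O] by blast
      have "y \<in> h -` W \<inter> topspace Z" if "y \<in> A" for y
      proof -
        have y: "y \<in> topspace Z" using that openin_subset[OF AB(1)] by blast
        moreover have "h y ` C \<subseteq> U"
        proof (intro image_subsetI)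
          fix c assume "c \<in> C"
          then have "(y, c) \<in> ?O" using that AB(4,5) by blast
          then show "h y c \<in> U" by simp
        qed
        ultimately show ?thesis using hz[OF y] W by simp
      qed
      then have "A \<subseteq> h -` W \<inter> topspace Z" by (rule subsetI)
      then show "\<exists>T. openin Z T \<and> z \<in> T \<and> T \<subseteq> h -` W \<inter> topspace Z"
        using AB by auto
    qed
  qed
qed

text \<open>In a compact Hausdorff space the closed, hence compact, neighbourhoods of a point form a
  base. If \<open>h z k\<close> lies in \<open>U\<close>, such a neighbourhood \<open>C\<close> of
  \<open>k\<close> is mapped into \<open>U\<close> by \<open>h z\<close>, and the subbasic set given
  by \<open>C\<close> and \<open>U\<close> keeps \<open>h y\<close> under control on all of
  \<open>C\<close> for \<open>y\<close> near \<open>z\<close>.\<close>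

lemma continuous_map_from_compact_open:
  assumes K: "compact_space K" "Hausdorff_space K"
    and h: "continuous_map Z (compact_open K X) h"
  shows "continuous_map (prod_topology Z K) X (\<lambda>(z, k). h z k)"
proof -
  have hz: "h z \<in> cmaps K X" if "z \<in> topspace Z" for z
    using continuous_map_funspace[OF h] that by auto
  have base: "neighbourhood_base_of (closedin K) K"
    using K by (simp add: neighbourhood_base_of_closedin compact_Hausdorff_imp_regular_space)
  show ?thesis
    unfolding continuous_map_def
  proof (intro conjI allI impI)
    show "(\<lambda>(z, k). h z k) \<in> topspace (prod_topology Z K) \<rightarrow> topspace X"
      using hz by (auto simp: cmaps_def dest: continuous_map_funspace)
    fix U assume U: "openin X U"
    let ?O = "{p \<in> topspace (prod_topology Z K). (\<lambda>(z, k). h z k) p \<in> U}"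
    show "openin (prod_topology Z K) ?O"
    proof (subst openin_subopen, intro ballI)
      fix p assume p: "p \<in> ?O"
      obtain z k where zk: "p = (z, k)" by fastforce
      have z: "z \<in> topspace Z" and k: "k \<in> topspace K" and hzk: "h z k \<in> U"
        using p zk by auto
      have "openin K {k \<in> topspace K. h z k \<in> U}"
      proof (rule openin_continuous_map_preimage[OF _ U])
        show "continuous_map K X (h z)" using hz[OF z] by (simp add: cmaps_def)
      qed
      then obtain V C where V: "openin K V" "closedin K C" "k \<in> V" "V \<subseteq> C"
          "C \<subseteq> {k \<in> topspace K. h z k \<in> U}"
        using base k hzk unfolding neighbourhood_base_of by (metis (mono_tags, lifting) mem_Collect_eq)
      have C: "compactin K C" using K(1) V(2) by (rule closedin_compact_space)
      let ?A = "{y \<in> topspace Z. h y \<in> {f \<in> cmaps K X. f ` C \<subseteq> U}}"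
      have "openin Z ?A"
        using h openin_compact_open[OF C U] by (rule openin_continuous_map_preimage)
      then have "openin (prod_topology Z K) (?A \<times> V)"
        using V(1) by (simp add: openin_prod_Times_iff)
      moreover have "p \<in> ?A \<times> V" using z zk V(3,5) hz[OF z] by auto
      moreover have "?A \<times> V \<subseteq> ?O"
        using V(4) openin_subset[OF V(1)] by auto
      ultimately show "\<exists>T. openin (prod_topology Z K) T \<and> p \<in> T \<and> T \<subseteq> ?O" by blast
    qed
  qed
qed


section \<open>Cubes and loop spaces\<close>

lemma compact_space_cube: "compact_space (cube n)"
  unfolding cube_def
  by (intro compact_space_product_topology[THEN iffD2] disjI2) (simp add: compact_space_subtopology)

lemma Hausdorff_space_cube: "Hausdorff_space (cube n)"
  unfolding cube_def Hausdorff_space_product_topology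
  by (intro disjI2) (simp add: Hausdorff_space_subtopology)

lemma topspace_cube: "topspace (cube n) = PiE {..<n} (\<lambda>_. {-pi..pi})"
  by (simp add: cube_def)

lemma mem_cube:
  "s \<in> topspace (cube n) \<longleftrightarrow>
     (\<forall>i. (i < n \<longrightarrow> -pi \<le> s i \<and> s i \<le> pi) \<and> (\<not> i < n \<longrightarrow> s i = undefined))"
  unfolding topspace_cube PiE_iff extensional_def lessThan_iff atLeastAtMost_iff mem_Collect_eq by blast

lemma cube_coord: "s \<in> topspace (cube n) \<Longrightarrow> i < n \<Longrightarrow> -pi \<le> s i \<and> s i \<le> pi"
  unfolding mem_cube by blast

lemma continuous_map_into_cube:
  "continuous_map Z (cube n) f \<longleftrightarrow>
     f \<in> topspace Z \<rightarrow> topspace (cube n) \<and> (\<forall>i<n. continuous_map Z euclideanreal (\<lambda>z. f z i))"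
proof -
  have "continuous_map Z (cube n) f \<longleftrightarrow> f \<in> topspace Z \<rightarrow> extensional {..<n} \<and>
     (\<forall>i<n. continuous_map Z euclideanreal (\<lambda>z. f z i) \<and> (\<lambda>z. f z i) \<in> topspace Z \<rightarrow> {-pi..pi})"
    unfolding cube_def continuous_map_componentwise continuous_map_in_subtopology by auto
  moreover have "f \<in> topspace Z \<rightarrow> topspace (cube n) \<longleftrightarrow> f \<in> topspace Z \<rightarrow> extensional {..<n} \<and>
     (\<forall>i<n. (\<lambda>z. f z i) \<in> topspace Z \<rightarrow> {-pi..pi})"
    unfolding topspace_cube PiE_def Pi_def by blast
  ultimately show ?thesis by blast
qed

lemma continuous_map_cube_coord:
  assumes "continuous_map Z (cube n) f" "i < n"
  shows "continuous_map Z euclideanreal (\<lambda>z. f z i)"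
  using assms by (simp add: continuous_map_into_cube)

text \<open>The disjunction covers two uses: overwriting a coordinate, as in concatenation, and
  appending a new last one, as in passing between loops and half loops.\<close>

lemma cube_update:
  assumes "s \<in> topspace (cube n)" "m = n \<and> j < n \<or> m = Suc n \<and> j = n" "-pi \<le> u" "u \<le> pi"
  shows "s(j := u) \<in> topspace (cube m)"
  unfolding mem_cube
proof (intro allI conjI impI)
  fix i
  show "-pi \<le> (s(j := u)) i" "(s(j := u)) i \<le> pi" if i: "i < m"
  proof -
    consider "i = j" | "i \<noteq> j" "i < n" using i assms(2) by linarith
    then have "-pi \<le> (s(j := u)) i \<and> (s(j := u)) i \<le> pi"
    proof cases
      case 1 then show ?thesis using assms(3,4) by simp
    next
      case 2 then show ?thesis using cube_coord[OF assms(1)] by simp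
    qed
    then show "-pi \<le> (s(j := u)) i" "(s(j := u)) i \<le> pi" by blast+
  qed
  show "(s(j := u)) i = undefined" if "\<not> i < m"
  proof -
    have "\<not> i < n" "i \<noteq> j" using that assms(2) by linarith+
    then have "s i = undefined" using assms(1) unfolding mem_cube by blast
    with \<open>i \<noteq> j\<close> show ?thesis by simp
  qed
qed

lemma cube_restrict:
  assumes "s \<in> topspace (cube (Suc n))" shows "restrict s {..<n} \<in> topspace (cube n)"
  unfolding mem_cube
proof (intro allI conjI impI)
  fix i
  show "-pi \<le> restrict s {..<n} i" "restrict s {..<n} i \<le> pi" if "i < n"
    using that cube_coord[OF assms, of i] by simp_all
qed simp

text \<open>\<open>cube_neg n\<close> looks only at the coordinates below \<open>n\<close>. On the
  larger cube it therefore drops the last coordinate while negating the others, and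
  \<open>unhalve\<close> uses it in this way.\<close>

lemma cube_neg_in_Suc:
  assumes "s \<in> topspace (cube (Suc n))" shows "cube_neg n s \<in> topspace (cube n)"
  unfolding mem_cube
proof (intro allI conjI impI)
  fix i
  show "-pi \<le> cube_neg n s i" "cube_neg n s i \<le> pi" if "i < n"
    using that cube_coord[OF assms, of i] by (simp_all add: cube_neg_def)
qed (simp add: cube_neg_def)

lemma cube_neg_in:
  assumes "s \<in> topspace (cube n)" shows "cube_neg n s \<in> topspace (cube n)"
  unfolding mem_cube
proof (intro allI conjI impI)
  fix i
  show "-pi \<le> cube_neg n s i" "cube_neg n s i \<le> pi" if "i < n"
    using that cube_coord[OF assms, of i] by (simp_all add: cube_neg_def)
qed (simp add: cube_neg_def)

lemma continuous_map_cube_update: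
  assumes "continuous_map Z (cube n) f" "continuous_map Z euclideanreal u"
    "m = n \<and> j < n \<or> m = Suc n \<and> j = n"
    "\<And>z. z \<in> topspace Z \<Longrightarrow> -pi \<le> u z \<and> u z \<le> pi"
  shows "continuous_map Z (cube m) (\<lambda>z. (f z)(j := u z))"
  unfolding continuous_map_into_cube
proof (intro conjI allI impI funcsetI)
  fix z assume "z \<in> topspace Z"
  then show "(f z)(j := u z) \<in> topspace (cube m)"
    using assms(3,4) continuous_map_funspace[OF assms(1)]
    by (intro cube_update[where n = n]) auto
next
  fix i assume "i < m"
  then show "continuous_map Z euclideanreal (\<lambda>z. ((f z)(j := u z)) i)"
    using assms continuous_map_cube_coord[OF assms(1), of i] by (cases "i = j") (auto simp: less_Suc_eq)
qed

lemma continuous_map_cube_restrict: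
  assumes "continuous_map Z (cube (Suc n)) f"
  shows "continuous_map Z (cube n) (\<lambda>z. restrict (f z) {..<n})"
  using assms cube_restrict unfolding continuous_map_into_cube by (auto simp: Pi_iff)

lemma continuous_map_cube_neg:
  assumes "continuous_map Z (cube (Suc n)) f"
  shows "continuous_map Z (cube n) (\<lambda>z. cube_neg n (f z))"
  using assms cube_neg_in_Suc unfolding continuous_map_into_cube
  by (auto simp: Pi_iff cube_neg_def intro!: continuous_intros)

section \<open>Loop spaces and equivariant loops\<close>

lemma mem_loop_space:
  "f \<in> topspace (loop_space d X x0) \<longleftrightarrow> f \<in> cmaps (cube d) X \<and> (\<forall>k\<in>cube_boundary d. f k = x0)"
  by (auto simp: loop_space_def)

text \<open>The form in which the exponential law is applied: continuity of a family of loops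
  becomes continuity of one map from a product into \<open>X\<close>, where coordinates can be
  rescaled and halves glued.\<close>

lemma continuous_map_into_loop_space:
  "continuous_map Z (loop_space d X x0) h \<longleftrightarrow>
     h \<in> topspace Z \<rightarrow> extensional (topspace (cube d)) \<and>
     continuous_map (prod_topology Z (cube d)) X (\<lambda>(z, k). h z k) \<and>
     (\<forall>z\<in>topspace Z. \<forall>k\<in>cube_boundary d. h z k = x0)"
proof -
  have "continuous_map Z (compact_open (cube d) X) h \<longleftrightarrow>
     h \<in> topspace Z \<rightarrow> extensional (topspace (cube d)) \<and>
     continuous_map (prod_topology Z (cube d)) X (\<lambda>(z, k). h z k)" (is "?L \<longleftrightarrow> ?R")
  proof
    assume ?L
    moreover have "h \<in> topspace Z \<rightarrow> cmaps (cube d) X"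
      using continuous_map_funspace[OF \<open>?L\<close>] by simp
    ultimately show ?R
      using continuous_map_from_compact_open[OF compact_space_cube Hausdorff_space_cube]
      by (auto simp: cmaps_def)
  next
    assume ?R
    then show ?L by (intro continuous_map_into_compact_open) auto
  qed
  then show ?thesis by (auto simp: loop_space_def continuous_map_in_subtopology)
qed

lemma loop_fixed_iff:
  "f \<in> loop_fixed d X g x0 \<longleftrightarrow> f \<in> topspace (loop_space d X x0) \<and>
     (\<forall>k\<in>topspace (cube d). g (f (cube_neg d k)) = f k)"
proof -
  have "loop_action d g f = f \<longleftrightarrow> (\<forall>k\<in>topspace (cube d). g (f (cube_neg d k)) = f k)"
    if "f \<in> extensional (topspace (cube d))"
    using that unfolding loop_action_def fun_eq_iff extensional_def by auto
  then show ?thesis unfolding loop_fixed_def Z2_fixed_def mem_loop_space cmaps_def by blast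
qed

lemma topspace_loop_fixed_space: "topspace (loop_fixed_space d X g x0) = loop_fixed d X g x0"
  unfolding loop_fixed_space_def by (auto simp: loop_fixed_iff)


section \<open>Homotopy classes of maps of cubes\<close>

text \<open>
  The slices of a homotopy in the sense of \<^const>\<open>homotopic_with\<close> are unconstrained off the cube,
  so the boundary condition must not depend on the values there.
\<close>

definition cube_cond_local :: "nat \<Rightarrow> (((nat \<Rightarrow> real) \<Rightarrow> 'b) \<Rightarrow> bool) \<Rightarrow> bool" where
  "cube_cond_local n P \<longleftrightarrow>
     (\<forall>f h. (\<forall>s\<in>topspace (cube n). f s = h s) \<longrightarrow> P f = P h)"

lemma cube_cond_local_abs_cond: "cube_cond_local n (abs_cond n y0)"
  unfolding cube_cond_local_def abs_cond_def cube_boundary_def by auto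

lemma cube_cond_local_rel_cond: "cube_cond_local n (rel_cond n B y0)"
  unfolding cube_cond_local_def rel_cond_def cube_boundary_def cube_J_def by auto

text \<open>Continuity of the two ends is not listed on the right because it comes with
  \<open>H\<close>. Extensionality has to be listed, since \<open>H\<close> determines the ends only
  on the cube.\<close>

lemma cube_homotopy_iff:
  assumes "cube_cond_local n P"
  shows "(f, f') \<in> cube_homotopy P n Y \<longleftrightarrow>
    f \<in> extensional (topspace (cube n)) \<and> f' \<in> extensional (topspace (cube n)) \<and>
    (\<exists>H. continuous_map (prod_topology (top_of_set {0..1::real}) (cube n)) Y (\<lambda>(t, s). H t s) \<and>
      (\<forall>s\<in>topspace (cube n). H 0 s = f s \<and> H 1 s = f' s) \<and> (\<forall>t\<in>{0..1}. P (H t)))"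
    (is "?L \<longleftrightarrow> ?R")
proof -
  have *: "homotopic_with P (cube n) Y f f' \<longleftrightarrow>
    (\<exists>h. continuous_map (prod_topology (top_of_set {0..1::real}) (cube n)) Y h \<and>
      (\<forall>s\<in>topspace (cube n). h (0, s) = f s) \<and> (\<forall>s\<in>topspace (cube n). h (1, s) = f' s) \<and>
      (\<forall>t\<in>{0..1}. P (\<lambda>s. h (t, s))))"
    using assms unfolding cube_cond_local_def by (intro homotopic_with) blast
  show ?thesis
  proof
    assume L: ?L
    then have "homotopic_with P (cube n) Y f f'" by (simp add: cube_homotopy_def)
    then obtain h where "continuous_map (prod_topology (top_of_set {0..1::real}) (cube n)) Y h"
      "\<forall>s\<in>topspace (cube n). h (0, s) = f s" "\<forall>s\<in>topspace (cube n). h (1, s) = f' s"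
      "\<forall>t\<in>{0..1}. P (\<lambda>s. h (t, s))"
      unfolding * by blast
    then show ?R using L
      by (intro conjI exI[of _ "\<lambda>t s. h (t, s)"]) (simp_all add: cube_homotopy_def cmaps_def)
  next
    assume R: ?R
    then obtain H where H: "continuous_map (prod_topology (top_of_set {0..1::real}) (cube n)) Y (\<lambda>(t, s). H t s)"
      "\<forall>s\<in>topspace (cube n). H 0 s = f s \<and> H 1 s = f' s" "\<forall>t\<in>{0..1}. P (H t)" by blast
    then have hom: "homotopic_with P (cube n) Y f f'"
      unfolding * by (intro exI[of _ "\<lambda>(t, s). H t s"]) simp
    then show ?L
      using R homotopic_with_imp_continuous_maps[OF hom] by (simp add: cube_homotopy_def cmaps_def)
  qed
qed

lemma equiv_cube_homotopy:
  "equiv {f \<in> cmaps (cube n) Y. P f} (cube_homotopy P n Y)"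
proof (rule equivI)
  show "cube_homotopy P n Y \<subseteq> {f \<in> cmaps (cube n) Y. P f} \<times> {f \<in> cmaps (cube n) Y. P f}"
    unfolding cube_homotopy_def by (auto dest: homotopic_with_imp_property)
  show "refl_on {f \<in> cmaps (cube n) Y. P f} (cube_homotopy P n Y)"
    by (auto simp: refl_on_def cube_homotopy_def cmaps_def)
  show "sym (cube_homotopy P n Y)"
    by (auto simp: sym_def cube_homotopy_def intro: homotopic_with_symD)
  show "trans (cube_homotopy P n Y)"
    unfolding trans_def cube_homotopy_def by (auto intro: homotopic_with_trans)
qed

lemma cube_homotopy_refl: "f \<in> cmaps (cube n) Y \<Longrightarrow> P f \<Longrightarrow> (f, f) \<in> cube_homotopy P n Y"
  by (auto simp: cube_homotopy_def cmaps_def)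

lemma cube_homotopy_memD:
  assumes "(f, h) \<in> cube_homotopy P n Y"
  shows "f \<in> cmaps (cube n) Y" "P f" "h \<in> cmaps (cube n) Y" "P h"
  using assms homotopic_with_imp_property[of P "cube n" Y f h] unfolding cube_homotopy_def by auto

text \<open>The product in \<open>cube_group\<close> is a union over all pairs of representatives,
  and \<open>compat\<close> makes all members of that union equal. It is a hypothesis because the
  absolute and the relative condition satisfy it for different reasons.\<close>

lemma cube_mult_classes:
  assumes compat: "\<And>f f' h h'. (f, f') \<in> cube_homotopy P n Y \<Longrightarrow> (h, h') \<in> cube_homotopy P n Y \<Longrightarrow>
      (cube_concat n f h, cube_concat n f' h') \<in> cube_homotopy P n Y"
    and "f \<in> cmaps (cube n) Y" "P f" "h \<in> cmaps (cube n) Y" "P h"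
  shows "cube_homotopy P n Y `` {f} \<otimes>\<^bsub>cube_group P n Y y0\<^esub> cube_homotopy P n Y `` {h}
    = cube_homotopy P n Y `` {cube_concat n f h}"
proof -
  let ?R = "cube_homotopy P n Y"
  have eq: "?R `` {cube_concat n f' h'} = ?R `` {cube_concat n f h}"
    if "f' \<in> ?R `` {f}" "h' \<in> ?R `` {h}" for f' h'
    using equiv_class_eq[OF equiv_cube_homotopy compat] that by blast
  \<comment> \<open>Without representatives the union would be empty, so reflexivity is what yields
    the inclusion from right to left.\<close>
  have ff: "f \<in> ?R `` {f}" and hh: "h \<in> ?R `` {h}"
    using assms(2-) cube_homotopy_refl by blast+
  have "(\<Union>f'\<in>?R `` {f}. \<Union>h'\<in>?R `` {h}. ?R `` {cube_concat n f' h'}) = ?R `` {cube_concat n f h}"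
  proof (rule subset_antisym)
    show "(\<Union>f'\<in>?R `` {f}. \<Union>h'\<in>?R `` {h}. ?R `` {cube_concat n f' h'}) \<subseteq> ?R `` {cube_concat n f h}"
      using eq by (intro UN_least) simp
    show "?R `` {cube_concat n f h} \<subseteq> (\<Union>f'\<in>?R `` {f}. \<Union>h'\<in>?R `` {h}. ?R `` {cube_concat n f' h'})"
      using ff hh by blast
  qed
  then show ?thesis by (simp add: cube_group_def)
qed

text \<open>Taking images of classes avoids choosing representatives. Preservation of the relation
  puts the image of a class inside a class; reflection, together with surjectivity of
  \<open>e\<close>, makes it the whole class.\<close>

lemma bij_betw_quotient:
  assumes R: "equiv A R" and S: "equiv B S" and e: "bij_betw e A B"
    and iff: "\<And>x y. x \<in> A \<Longrightarrow> y \<in> A \<Longrightarrow> (x, y) \<in> R \<longleftrightarrow> (e x, e y) \<in> S"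
  shows "bij_betw ((`) e) (A // R) (B // S)"
    and "\<And>x. x \<in> A \<Longrightarrow> e ` (R `` {x}) = S `` {e x}"
proof -
  have RA: "R \<subseteq> A \<times> A" and SB: "S \<subseteq> B \<times> B" using R S by (auto simp: equiv_def)
  have inj: "inj_on e A" and im: "e ` A = B" using e by (auto simp: bij_betw_def)
  show cls: "e ` (R `` {x}) = S `` {e x}" if x: "x \<in> A" for x
  proof (rule subset_antisym; rule subsetI)
    fix z assume "z \<in> e ` (R `` {x})"
    then obtain y where "(x, y) \<in> R" "z = e y" by blast
    then show "z \<in> S `` {e x}" using iff[OF x] RA by blast
  next
    fix z assume z: "z \<in> S `` {e x}"
    then obtain y where "y \<in> A" "z = e y" using SB im by blast
    then show "z \<in> e ` (R `` {x})" using iff[OF x] z by blast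
  qed
  have "inj_on ((`) e) (A // R)"
  proof (rule inj_onI)
    fix C C' assume "C \<in> A // R" "C' \<in> A // R" and eq: "e ` C = e ` C'"
    then have "C \<subseteq> A" "C' \<subseteq> A" using R by (auto simp: quotient_def dest: subsetD[OF RA])
    then show "C = C'" using inj_on_image_eq_iff[OF inj] eq by blast
  qed
  moreover have "(`) e ` (A // R) = B // S"
    unfolding quotient_def using cls im by (auto simp: image_iff)
  ultimately show "bij_betw ((`) e) (A // R) (B // S)" by (simp add: bij_betw_def)
qed


section \<open>The group structure on homotopy classes\<close>

lemma cube_update_0:
  assumes "s \<in> topspace (cube n)" "n \<ge> 1" "-pi \<le> u" "u \<le> pi"
  shows "s(0 := u) \<in> topspace (cube n)"
  using assms by (intro cube_update[OF assms(1)]) auto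

text \<open>Each group law holds strictly up to such a change of the first coordinate.\<close>

lemma homotopic_reparametrization:
  assumes n: "n \<ge> 1" and f: "f \<in> cmaps (cube n) Y" "abs_cond n y0 f"
    and r: "continuous_on {-pi..pi} r" "\<And>u. -pi \<le> u \<Longrightarrow> u \<le> pi \<Longrightarrow> -pi \<le> r u \<and> r u \<le> pi"
    and q: "continuous_on {-pi..pi} q" "\<And>u. -pi \<le> u \<Longrightarrow> u \<le> pi \<Longrightarrow> -pi \<le> q u \<and> q u \<le> pi"
    and ends: "r (-pi) = q (-pi)" "r pi = q pi" "r (-pi) \<in> {-pi, pi}" "r pi \<in> {-pi, pi}"
  shows "(\<lambda>s\<in>topspace (cube n). f (s(0 := r (s 0))), \<lambda>s\<in>topspace (cube n). f (s(0 := q (s 0))))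
    \<in> cube_homotopy (abs_cond n y0) n Y"
  unfolding cube_homotopy_iff[OF cube_cond_local_abs_cond]
proof (intro conjI exI)
  \<comment> \<open>The straight line from \<open>r\<close> to \<open>q\<close>, which stays in I by
    convexity.\<close>
  let ?c = "\<lambda>(t::real) u. (1 - t) * r u + t * q u"
  let ?H = "\<lambda>t s. f (s(0 := ?c t (s 0)))"
  let ?P = "prod_topology (top_of_set {0..1::real}) (cube n)"
  have c: "-pi \<le> ?c t u \<and> ?c t u \<le> pi" if "t \<in> {0..1}" "-pi \<le> u" "u \<le> pi" for t u
    using convexD_alt[OF convex_real_interval(5)[of "-pi" pi], of "r u" "q u" t] r(2)[OF that(2,3)] q(2)[OF that(2,3)] that(1)
    by simp
  show "\<forall>t\<in>{0..1}. abs_cond n y0 (?H t)"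
    unfolding abs_cond_def
  proof (intro ballI)
    fix t :: real and s assume t: "t \<in> {0..1}" and s: "s \<in> cube_boundary n"
    then have sc: "s \<in> topspace (cube n)" by (simp add: cube_boundary_def)
    have s0: "-pi \<le> s 0 \<and> s 0 \<le> pi" using cube_coord[OF sc, of 0] n by simp
    obtain i where i: "i < n" "s i = -pi \<or> s i = pi" using s by (auto simp: cube_boundary_def)
    have up: "s(0 := ?c t (s 0)) \<in> topspace (cube n)"
      using c[OF t] s0 by (intro cube_update_0[OF sc n]) auto
    have "s(0 := ?c t (s 0)) \<in> cube_boundary n"
    \<comment> \<open>On the two faces of the first coordinate \<open>r\<close> and \<open>q\<close>
      agree, so the homotopy does not move there and its value is an endpoint of I. The other faces
      are not affected by a change of coordinate \<open>0\<close>.\<close>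
    proof (cases "i = 0")
      case True
      then have "?c t (s 0) = r (s 0)" "r (s 0) \<in> {-pi, pi}"
        using i ends by (auto simp: algebra_simps)
      then show ?thesis using up n by (auto simp: cube_boundary_def intro!: exI[of _ 0])
    next
      case False
      then show ?thesis using up i by (auto simp: cube_boundary_def intro!: exI[of _ i])
    qed
    then show "?H t s = y0" using f(2) by (simp add: abs_cond_def)
  qed
  have t: "continuous_map ?P euclideanreal fst"
    using continuous_map_fst[of "top_of_set {0..1::real}" "cube n"] continuous_map_into_fulltopology by blast
  have s: "continuous_map ?P (cube n) snd" by (rule continuous_map_snd)
  have s0: "continuous_map ?P (top_of_set {-pi..pi}) (\<lambda>p. snd p 0)"
    unfolding continuous_map_in_subtopology
    using continuous_map_cube_coord[OF s, of 0] n cube_coord[of _ n 0] by auto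
  have "continuous_map ?P euclideanreal (\<lambda>p. r (snd p 0))" "continuous_map ?P euclideanreal (\<lambda>p. q (snd p 0))"
    using continuous_map_compose[OF s0, of euclideanreal r] continuous_map_compose[OF s0, of euclideanreal q] r(1) q(1)
    by (simp_all add: o_def)
  then have "continuous_map ?P euclideanreal (\<lambda>p. ?c (fst p) (snd p 0))"
    using t by (intro continuous_intros) auto
  then have "continuous_map ?P (cube n) (\<lambda>p. (snd p)(0 := ?c (fst p) (snd p 0)))"
  proof (rule continuous_map_cube_update[OF s])
    fix p assume p: "p \<in> topspace ?P"
    then have "-pi \<le> snd p 0 \<and> snd p 0 \<le> pi" using cube_coord[of "snd p" n 0] n by auto
    then show "-pi \<le> ?c (fst p) (snd p 0) \<and> ?c (fst p) (snd p 0) \<le> pi"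
      using p by (intro c) auto
  qed (use n in auto)
  from continuous_map_compose[OF this, of Y f]
  show "continuous_map ?P Y (\<lambda>(t, s). ?H t s)"
    using f(1) by (simp add: o_def cmaps_def case_prod_unfold)
qed auto

text \<open>The two homotopies are concatenated at each time. They fit together because both are at
  the base point on the faces that get glued.\<close>

lemma cube_concat_homotopic:
  assumes n: "n \<ge> 1"
    and f: "(f, f') \<in> cube_homotopy (abs_cond n y0) n Y"
    and h: "(h, h') \<in> cube_homotopy (abs_cond n y0) n Y"
  shows "(cube_concat n f h, cube_concat n f' h') \<in> cube_homotopy (abs_cond n y0) n Y"
proof -
  let ?P = "prod_topology (top_of_set {0..1::real}) (cube n)"
  obtain F where F: "continuous_map ?P Y (\<lambda>(t, s). F t s)"
      "\<And>s. s \<in> topspace (cube n) \<Longrightarrow> F 0 s = f s \<and> F 1 s = f' s"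
      "\<And>t. t \<in> {0..1} \<Longrightarrow> abs_cond n y0 (F t)"
    using f unfolding cube_homotopy_iff[OF cube_cond_local_abs_cond] by blast
  obtain H where H: "continuous_map ?P Y (\<lambda>(t, s). H t s)"
      "\<And>s. s \<in> topspace (cube n) \<Longrightarrow> H 0 s = h s \<and> H 1 s = h' s"
      "\<And>t. t \<in> {0..1} \<Longrightarrow> abs_cond n y0 (H t)"
    using h unfolding cube_homotopy_iff[OF cube_cond_local_abs_cond] by blast
  \<comment> \<open>Clamping with \<open>min\<close> and \<open>max\<close> makes each rescaling a
    map of the whole cube into itself. On its own half it is the formula of
    \<open>cube_concat\<close>, and both branches are continuous everywhere before they are
    glued.\<close>
  let ?a = "\<lambda>s::nat \<Rightarrow> real. s(0 := 2 * min 0 (s 0) + pi)"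
  let ?b = "\<lambda>s::nat \<Rightarrow> real. s(0 := 2 * max 0 (s 0) - pi)"
  have a: "?a s \<in> topspace (cube n)" and b: "?b s \<in> topspace (cube n)"
    if "s \<in> topspace (cube n)" for s
    using cube_coord[OF that, of 0] n by (auto intro!: cube_update_0[OF that n])
  let ?K = "\<lambda>t s. if s 0 \<le> 0 then F t (?a s) else H t (?b s)"
  have bd: "?a s \<in> cube_boundary n" "?b s \<in> cube_boundary n"
    if sb: "s \<in> cube_boundary n" for s
  proof -
    have sc: "s \<in> topspace (cube n)" using sb by (simp add: cube_boundary_def)
    obtain i where i: "i < n" "s i = -pi \<or> s i = pi" using sb by (auto simp: cube_boundary_def)
    show "?a s \<in> cube_boundary n"
    proof (cases "i = 0")
      case True
      then have "2 * min 0 (s 0) + pi = -pi \<or> 2 * min 0 (s 0) + pi = pi" using i pi_gt_zero by auto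
      then show ?thesis using a[OF sc] n by (auto simp: cube_boundary_def intro!: exI[of _ 0])
    next
      case False
      then show ?thesis using a[OF sc] i by (auto simp: cube_boundary_def intro!: exI[of _ i])
    qed
    show "?b s \<in> cube_boundary n"
    proof (cases "i = 0")
      case True
      then have "2 * max 0 (s 0) - pi = -pi \<or> 2 * max 0 (s 0) - pi = pi" using i pi_gt_zero by auto
      then show ?thesis using b[OF sc] n by (auto simp: cube_boundary_def intro!: exI[of _ 0])
    next
      case False
      then show ?thesis using b[OF sc] i by (auto simp: cube_boundary_def intro!: exI[of _ i])
    qed
  qed
  show ?thesis
    unfolding cube_homotopy_iff[OF cube_cond_local_abs_cond]
  proof (intro conjI exI)
    show "\<forall>t\<in>{0..1}. abs_cond n y0 (?K t)"
    proof (intro ballI)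
      fix t :: real assume t: "t \<in> {0..1}"
      show "abs_cond n y0 (?K t)"
        unfolding abs_cond_def
      proof
        fix s assume s: "s \<in> cube_boundary n"
        show "?K t s = y0"
          using F(3)[OF t] H(3)[OF t] bd[OF s] by (auto simp only: abs_cond_def split: if_split)
      qed
    qed
    show "\<forall>s\<in>topspace (cube n). ?K 0 s = cube_concat n f h s \<and> ?K 1 s = cube_concat n f' h' s"
    proof
      fix s assume s: "s \<in> topspace (cube n)"
      show "?K 0 s = cube_concat n f h s \<and> ?K 1 s = cube_concat n f' h' s"
        using s F(2)[OF a[OF s]] H(2)[OF b[OF s]]
        by (cases "s 0 \<le> 0") (simp_all add: cube_concat_def min_def max_def)
    qed
    have t: "continuous_map ?P (top_of_set {0..1::real}) fst" by (rule continuous_map_fst)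
    have s: "continuous_map ?P (cube n) snd" by (rule continuous_map_snd)
    have s0: "continuous_map ?P euclideanreal (\<lambda>p. snd p 0)"
      using continuous_map_cube_coord[OF s, of 0] n by simp
    have "continuous_map ?P (cube n) (\<lambda>p. ?a (snd p))"
    proof (rule continuous_map_cube_update[OF s])
      show "continuous_map ?P euclideanreal (\<lambda>p. 2 * min 0 (snd p 0) + pi)"
        using s0 by (intro continuous_intros) auto
      show "-pi \<le> 2 * min 0 (snd p 0) + pi \<and> 2 * min 0 (snd p 0) + pi \<le> pi" if "p \<in> topspace ?P" for p
        using that cube_coord[of "snd p" n 0] n by auto
    qed (use n in auto)
    from continuous_map_compose[OF continuous_map_pairedI[OF t this] F(1)]
    have c1: "continuous_map ?P Y (\<lambda>p. F (fst p) (?a (snd p)))" by (simp add: o_def)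
    have "continuous_map ?P (cube n) (\<lambda>p. ?b (snd p))"
    proof (rule continuous_map_cube_update[OF s])
      show "continuous_map ?P euclideanreal (\<lambda>p. 2 * max 0 (snd p 0) - pi)"
        using s0 by (intro continuous_intros) auto
      show "-pi \<le> 2 * max 0 (snd p 0) - pi \<and> 2 * max 0 (snd p 0) - pi \<le> pi" if "p \<in> topspace ?P" for p
        using that cube_coord[of "snd p" n 0] n by auto
    qed (use n in auto)
    from continuous_map_compose[OF continuous_map_pairedI[OF t this] H(1)]
    have c2: "continuous_map ?P Y (\<lambda>p. H (fst p) (?b (snd p)))" by (simp add: o_def)
    have "continuous_map ?P Y (\<lambda>p. if snd p 0 \<le> 0 then F (fst p) (?a (snd p)) else H (fst p) (?b (snd p)))"
    proof (rule continuous_map_cases_le)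
      \<comment> \<open>At first coordinate 0 the rescaled first coordinates are pi and -pi, so both
        branches are evaluated on the boundary of the cube.\<close>
      fix p assume p: "p \<in> topspace ?P" and 0: "snd p 0 = 0"
      have sp: "snd p \<in> topspace (cube n)" and tp: "fst p \<in> {0..1}" using p by auto
      have "?a (snd p) \<in> cube_boundary n" "?b (snd p) \<in> cube_boundary n"
        using a[OF sp] b[OF sp] n 0 by (auto simp: cube_boundary_def intro!: exI[of _ 0])
      then show "F (fst p) (?a (snd p)) = H (fst p) (?b (snd p))"
        using F(3)[OF tp] H(3)[OF tp] unfolding abs_cond_def by metis
    qed (use s0 c1 c2 in \<open>simp_all add: continuous_map_from_subtopology\<close>)
    then show "continuous_map ?P Y (\<lambda>(t, s). ?K t s)" by (simp add: case_prod_unfold)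
  qed (simp_all add: cube_concat_def)
qed

text \<open>Apply the compatibility with homotopies to constant homotopies: being related by
  \<open>cube_homotopy\<close> includes continuity and the boundary condition for both ends.\<close>

lemma cube_concat_closed:
  assumes "n \<ge> 1" "f \<in> cmaps (cube n) Y" "abs_cond n y0 f" "h \<in> cmaps (cube n) Y" "abs_cond n y0 h"
  shows "cube_concat n f h \<in> cmaps (cube n) Y" "abs_cond n y0 (cube_concat n f h)"
  using cube_homotopy_memD[OF cube_concat_homotopic[OF assms(1)
      cube_homotopy_refl[where P = "abs_cond n y0"] cube_homotopy_refl[where P = "abs_cond n y0"]]] assms(2-)
  by blast+

lemma cube_const_closed:
  assumes "y0 \<in> topspace Y"
  shows "cube_const n y0 \<in> cmaps (cube n) Y" "abs_cond n y0 (cube_const n y0)"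
proof -
  have "continuous_map (cube n) Y (cube_const n y0)"
    by (rule continuous_map_eq[of _ _ "\<lambda>_. y0"]) (auto simp: assms cube_const_def)
  then show "cube_const n y0 \<in> cmaps (cube n) Y" "abs_cond n y0 (cube_const n y0)"
    by (auto simp: cmaps_def cube_const_def abs_cond_def cube_boundary_def)
qed

lemma cube_reparam_id:
  assumes "f \<in> cmaps (cube n) Y" shows "(\<lambda>s\<in>topspace (cube n). f (s(0 := s 0))) = f"
  using assms by (simp add: cmaps_def extensional_restrict)

lemma cube_concat_const:
  assumes n: "n \<ge> 1" and f: "f \<in> cmaps (cube n) Y" "abs_cond n y0 f"
  shows "(cube_concat n (cube_const n y0) f, f) \<in> cube_homotopy (abs_cond n y0) n Y"
proof -
  \<comment> \<open>This waits at -pi, where \<open>f\<close> takes the value \<open>y0\<close>,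
    during the first half and runs through all of I during the second.\<close>
  let ?r = "\<lambda>u::real. max (-pi) (2 * u - pi)"
  have "cube_concat n (cube_const n y0) f = (\<lambda>s\<in>topspace (cube n). f (s(0 := ?r (s 0))))"
    unfolding cube_concat_def
  proof (rule restrict_ext)
    fix s assume s: "s \<in> topspace (cube n)"
    have s0: "-pi \<le> s 0" "s 0 \<le> pi" using cube_coord[OF s, of 0] n by auto
    show "(if s 0 \<le> 0 then cube_const n y0 (s(0 := 2 * s 0 + pi)) else f (s(0 := 2 * s 0 - pi)))
      = f (s(0 := ?r (s 0)))"
    proof (cases "s 0 \<le> 0")
      case True
      then have r: "?r (s 0) = -pi" by simp
      have "s(0 := 2 * s 0 + pi) \<in> topspace (cube n)"
        using True s0 by (intro cube_update_0[OF s n]) auto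
      moreover have "s(0 := -pi) \<in> cube_boundary n"
        using cube_update_0[OF s n, of "-pi"] n by (auto simp: cube_boundary_def intro!: exI[of _ 0])
      ultimately show ?thesis
        using True f(2) unfolding r by (simp add: abs_cond_def cube_const_def)
    next
      case False
      then have "?r (s 0) = 2 * s 0 - pi" by simp
      then show ?thesis using False by simp
    qed
  qed
  moreover have "(\<lambda>s\<in>topspace (cube n). f (s(0 := ?r (s 0))), \<lambda>s\<in>topspace (cube n). f (s(0 := s 0)))
      \<in> cube_homotopy (abs_cond n y0) n Y"
    by (rule homotopic_reparametrization[OF n f]) (auto intro!: continuous_intros)
  ultimately show ?thesis by (simp only: cube_reparam_id[OF f(1)])
qed

lemma cube_concat_assoc:
  assumes n: "n \<ge> 1" and f: "f \<in> cmaps (cube n) Y" "abs_cond n y0 f"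
    and h: "h \<in> cmaps (cube n) Y" "abs_cond n y0 h" and k: "k \<in> cmaps (cube n) Y" "abs_cond n y0 k"
  shows "(cube_concat n (cube_concat n f h) k, cube_concat n f (cube_concat n h k))
    \<in> cube_homotopy (abs_cond n y0) n Y"
proof -
  \<comment> \<open>The piecewise linear map taking [-pi,-pi/2], [-pi/2,0], [0,pi] onto [-pi,0],
    [0,pi/2], [pi/2,pi], that is, the intervals used by the left bracketing onto those used by the
    right one. The slopes 2, 1, 1/2 decrease, so the map is concave and equals the minimum of its
    three linear pieces.\<close>
  let ?r = "\<lambda>u::real. min (2 * u + pi) (min (u + pi / 2) ((u + pi) / 2))"
  let ?F = "cube_concat n f (cube_concat n h k)"
  have F: "?F \<in> cmaps (cube n) Y" "abs_cond n y0 ?F"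
    by (rule cube_concat_closed[OF n f cube_concat_closed[OF n h k]])+
  have r: "-pi \<le> ?r u \<and> ?r u \<le> pi" if "-pi \<le> u" "u \<le> pi" for u
    using that by (auto simp: min_def field_simps)
  have "cube_concat n (cube_concat n f h) k = (\<lambda>s\<in>topspace (cube n). ?F (s(0 := ?r (s 0))))"
    unfolding cube_concat_def[of n "cube_concat n f h"]
  proof (rule restrict_ext)
    fix s assume s: "s \<in> topspace (cube n)"
    have s0: "-pi \<le> s 0" "s 0 \<le> pi" using cube_coord[OF s, of 0] n by auto
    have up: "s(0 := u) \<in> topspace (cube n)" if "-pi \<le> u" "u \<le> pi" for u
      using cube_update_0[OF s n that] .
    consider "s 0 \<le> -pi / 2" | "-pi / 2 < s 0" "s 0 \<le> 0" | "0 < s 0" by linarith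
    then show "(if s 0 \<le> 0 then cube_concat n f h (s(0 := 2 * s 0 + pi)) else k (s(0 := 2 * s 0 - pi)))
      = ?F (s(0 := ?r (s 0)))"
    proof cases
      case 1
      then have "s 0 \<le> 0" "2 * s 0 + pi \<le> 0" using pi_gt_zero by linarith+
      moreover from this have "?r (s 0) = 2 * s 0 + pi"
      proof (intro min_absorb1 min.boundedI)
        have "2 * x + p \<le> (x + p) / 2" if "0 \<le> p" "2 * x + p \<le> 0" for x p :: real
          using that by (simp add: field_simps)
        from this[OF pi_ge_zero] show "2 * s 0 + pi \<le> (s 0 + pi) / 2"
          using \<open>2 * s 0 + pi \<le> 0\<close> by blast
      qed (use \<open>2 * s 0 + pi \<le> 0\<close> in simp)
      ultimately show ?thesis using up[of "2 * s 0 + pi"] s0 by (simp add: cube_concat_def)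
    next
      case 2
      then have e: "?r (s 0) = s 0 + pi / 2" "s 0 \<le> 0" "\<not> 2 * s 0 + pi \<le> 0" "\<not> s 0 + pi / 2 \<le> 0"
        "2 * (s 0 + pi / 2) - pi = 2 * s 0"
        using pi_gt_zero by (auto simp: min_def field_simps)
      have up1: "s(0 := 2 * s 0 + pi) \<in> topspace (cube n)" "s(0 := s 0 + pi / 2) \<in> topspace (cube n)"
        "s(0 := 2 * s 0) \<in> topspace (cube n)"
        using 2 s0 by (auto intro!: up)
      have "2 * (2 * s 0 + pi) - pi = 2 * (2 * s 0) + pi" by simp
      then show ?thesis using up1 e by (simp add: cube_concat_def add.commute)
    next
      case 3
      then have e: "?r (s 0) = (s 0 + pi) / 2" "\<not> s 0 \<le> 0" "\<not> (s 0 + pi) / 2 \<le> 0"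
        "2 * ((s 0 + pi) / 2) - pi = s 0"
        using pi_gt_zero s0 by (auto simp: min_def field_simps)
      have "s(0 := (s 0 + pi) / 2) \<in> topspace (cube n)"
        using 3 s0 by (intro up) (auto simp: field_simps)
      moreover have "?F (s(0 := (s 0 + pi) / 2))
          = cube_concat n h k (s(0 := 2 * ((s 0 + pi) / 2) - pi))"
        using calculation e(3) unfolding cube_concat_def[of n f] by (simp only: restrict_apply' if_False fun_upd_same fun_upd_upd)
      ultimately show ?thesis using e s by (simp add: cube_concat_def[of n h k])
    qed
  qed
  moreover have "(\<lambda>s\<in>topspace (cube n). ?F (s(0 := ?r (s 0))), \<lambda>s\<in>topspace (cube n). ?F (s(0 := s 0)))
      \<in> cube_homotopy (abs_cond n y0) n Y"
  proof (rule homotopic_reparametrization[OF n F _ r])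
    show "continuous_on {-pi..pi} ?r" by (intro continuous_intros) auto
    show "?r (-pi) = -pi" "?r pi = pi" "?r (-pi) \<in> {-pi, pi}" "?r pi \<in> {-pi, pi}"
      using pi_gt_zero by (auto simp: min_def)
  qed auto
  ultimately show ?thesis by (simp only: cube_reparam_id[OF F(1)])
qed

lemma cube_concat_inverse:
  assumes n: "n \<ge> 1" and f: "f \<in> cmaps (cube n) Y" "abs_cond n y0 f"
  defines "f' \<equiv> \<lambda>s\<in>topspace (cube n). f (s(0 := - s 0))"
  shows "f' \<in> cmaps (cube n) Y" "abs_cond n y0 f'"
    and "(cube_concat n f' f, cube_const n y0) \<in> cube_homotopy (abs_cond n y0) n Y"
proof -
  \<comment> \<open>Reparametrizing by -u and comparing with itself yields continuity and the
    boundary condition of \<open>f'\<close> in one stroke.\<close>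
  have "(f', f') \<in> cube_homotopy (abs_cond n y0) n Y"
    unfolding f'_def
    by (rule homotopic_reparametrization[OF n f]) (auto intro!: continuous_intros)
  then show "f' \<in> cmaps (cube n) Y" "abs_cond n y0 f'" by (rule cube_homotopy_memD)+
  \<comment> \<open>Following \<open>f'\<close> by \<open>f\<close> runs the first coordinate from
    pi down to -pi and back. Both ends are at pi, so this path contracts to the constant pi, where
    \<open>f\<close> takes the value \<open>y0\<close>.\<close>
  let ?r = "\<lambda>u::real. 2 * \<bar>u\<bar> - pi"
  have "cube_concat n f' f = (\<lambda>s\<in>topspace (cube n). f (s(0 := ?r (s 0))))"
    unfolding cube_concat_def
  proof (rule restrict_ext)
    fix s assume s: "s \<in> topspace (cube n)"
    have s0: "-pi \<le> s 0" "s 0 \<le> pi" using cube_coord[OF s, of 0] n by auto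
    show "(if s 0 \<le> 0 then f' (s(0 := 2 * s 0 + pi)) else f (s(0 := 2 * s 0 - pi)))
      = f (s(0 := ?r (s 0)))"
    proof (cases "s 0 \<le> 0")
      case True
      then have "s(0 := 2 * s 0 + pi) \<in> topspace (cube n)"
        using s0 by (intro cube_update_0[OF s n]) auto
      moreover have "- (2 * s 0 + pi) = ?r (s 0)" using True by simp
      ultimately show ?thesis using True by (simp add: f'_def)
    qed simp
  qed
  moreover have "cube_const n y0 = (\<lambda>s\<in>topspace (cube n). f (s(0 := pi)))"
    unfolding cube_const_def
  proof (rule restrict_ext)
    fix s assume "s \<in> topspace (cube n)"
    then have "s(0 := pi) \<in> cube_boundary n"
      using cube_update_0[of s n pi] n by (auto simp: cube_boundary_def intro!: exI[of _ 0])
    then show "y0 = f (s(0 := pi))" using f(2) by (simp add: abs_cond_def)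
  qed
  moreover have "(\<lambda>s\<in>topspace (cube n). f (s(0 := ?r (s 0))), \<lambda>s\<in>topspace (cube n). f (s(0 := pi)))
      \<in> cube_homotopy (abs_cond n y0) n Y"
    by (rule homotopic_reparametrization[OF n f, where q = "\<lambda>_. pi"]) (auto intro!: continuous_intros)
  ultimately show "(cube_concat n f' f, cube_const n y0) \<in> cube_homotopy (abs_cond n y0) n Y" by simp
qed

theorem group_homotopy_group:
  assumes n: "n \<ge> 1" and y0: "y0 \<in> topspace Y"
  shows "group (homotopy_group n Y y0)"
proof -
  let ?P = "abs_cond n y0"
  let ?G = "homotopy_group n Y y0"
  let ?R = "cube_homotopy ?P n Y"
  have carrier: "carrier ?G = cube_classes ?P n Y"
    and one: "\<one>\<^bsub>?G\<^esub> = ?R `` {cube_const n y0}"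
    by (simp_all add: homotopy_group_def cube_group_def)
  have classI: "?R `` {f} \<in> carrier ?G" if "f \<in> cmaps (cube n) Y" "?P f" for f
    using that unfolding carrier cube_classes_def by (intro quotientI) simp
  have classE: "\<exists>f. f \<in> cmaps (cube n) Y \<and> ?P f \<and> A = ?R `` {f}" if "A \<in> carrier ?G" for A
    using that unfolding carrier cube_classes_def by (auto elim: quotientE)
  have mult: "?R `` {f} \<otimes>\<^bsub>?G\<^esub> ?R `` {h} = ?R `` {cube_concat n f h}"
    if "f \<in> cmaps (cube n) Y" "?P f" "h \<in> cmaps (cube n) Y" "?P h" for f h
    unfolding homotopy_group_def
    using that by (intro cube_mult_classes cube_concat_homotopic[OF n])
  have eq: "?R `` {f} = ?R `` {h}" if "(f, h) \<in> ?R" for f h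
    using equiv_class_eq[OF equiv_cube_homotopy that] .
  note const = cube_const_closed[OF y0, of n]
  show ?thesis
  proof (rule groupI)
    show "\<one>\<^bsub>?G\<^esub> \<in> carrier ?G" unfolding one using const by (rule classI)
  next
    fix A B assume "A \<in> carrier ?G" "B \<in> carrier ?G"
    then obtain f h where f: "f \<in> cmaps (cube n) Y" "?P f" "A = ?R `` {f}"
      and h: "h \<in> cmaps (cube n) Y" "?P h" "B = ?R `` {h}" using classE by meson
    show "A \<otimes>\<^bsub>?G\<^esub> B \<in> carrier ?G"
      unfolding f(3) h(3) mult[OF f(1,2) h(1,2)]
      using cube_concat_closed[OF n f(1,2) h(1,2)] by (rule classI)
  next
    fix A B C assume "A \<in> carrier ?G" "B \<in> carrier ?G" "C \<in> carrier ?G"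
    then obtain f h k where f: "f \<in> cmaps (cube n) Y" "?P f" "A = ?R `` {f}"
      and h: "h \<in> cmaps (cube n) Y" "?P h" "B = ?R `` {h}"
      and k: "k \<in> cmaps (cube n) Y" "?P k" "C = ?R `` {k}" using classE by meson
    show "A \<otimes>\<^bsub>?G\<^esub> B \<otimes>\<^bsub>?G\<^esub> C = A \<otimes>\<^bsub>?G\<^esub> (B \<otimes>\<^bsub>?G\<^esub> C)"
      unfolding f(3) h(3) k(3) mult[OF f(1,2) h(1,2)] mult[OF h(1,2) k(1,2)]
        mult[OF cube_concat_closed[OF n f(1,2) h(1,2)] k(1,2)]
        mult[OF f(1,2) cube_concat_closed[OF n h(1,2) k(1,2)]]
      by (rule eq[OF cube_concat_assoc[OF n f(1,2) h(1,2) k(1,2)]])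
  next
    fix A assume "A \<in> carrier ?G"
    then obtain f where f: "f \<in> cmaps (cube n) Y" "?P f" "A = ?R `` {f}" using classE by meson
    show "\<one>\<^bsub>?G\<^esub> \<otimes>\<^bsub>?G\<^esub> A = A"
      unfolding one f(3) mult[OF const f(1,2)] by (rule eq[OF cube_concat_const[OF n f(1,2)]])
    note inv = cube_concat_inverse[OF n f(1,2)]
    show "\<exists>B\<in>carrier ?G. B \<otimes>\<^bsub>?G\<^esub> A = \<one>\<^bsub>?G\<^esub>"
      using classI[OF inv(1,2)] eq[OF inv(3)] unfolding one f(3) mult[OF inv(1,2) f(1,2), symmetric] by blast
  qed
qed


section \<open>Restricting equivariant loops to half of the last coordinate\<close>

text \<open>The factor (u + pi)/2 carries I onto [0,pi]. Its orientation is dictated by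
  \<open>cube_J\<close>: the face \<open>s D = pi\<close> goes to the boundary face
  \<open>k d = pi\<close> of the loop cube, and the remaining face \<open>s D = -pi\<close> goes to
  the middle slice \<open>k d = 0\<close>.\<close>

definition halve ::
  "nat \<Rightarrow> nat \<Rightarrow> ((nat \<Rightarrow> real) \<Rightarrow> (nat \<Rightarrow> real) \<Rightarrow> 'a) \<Rightarrow> (nat \<Rightarrow> real) \<Rightarrow> (nat \<Rightarrow> real) \<Rightarrow> 'a" where
  "halve D d f = (\<lambda>s\<in>topspace (cube (Suc D)). \<lambda>k\<in>topspace (cube d).
     f (restrict s {..<D}) (k(d := (s D + pi) / 2)))"

text \<open>The term \<open>2 * \<bar>k d\<bar> - pi\<close> inverts the rescaling on both halves at
  once. The second branch is forced by equivariance: the value at k must be g of the value at -k,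
  whose last coordinate is nonnegative and whose other coordinates are
  \<open>cube_neg d k\<close>.\<close>

definition unhalve ::
  "('a \<Rightarrow> 'a) \<Rightarrow> nat \<Rightarrow> nat \<Rightarrow> ((nat \<Rightarrow> real) \<Rightarrow> (nat \<Rightarrow> real) \<Rightarrow> 'a) \<Rightarrow>
    (nat \<Rightarrow> real) \<Rightarrow> (nat \<Rightarrow> real) \<Rightarrow> 'a" where
  "unhalve g D d G = (\<lambda>s\<in>topspace (cube D). \<lambda>k\<in>topspace (cube (Suc d)).
     if 0 \<le> k d then G (s(D := 2 * \<bar>k d\<bar> - pi)) (restrict k {..<d})
     else g (G (s(D := 2 * \<bar>k d\<bar> - pi)) (cube_neg d k)))"

lemma halve_coord:
  assumes "s \<in> topspace (cube (Suc D))" "k \<in> topspace (cube d)"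
  shows "k(d := (s D + pi) / 2) \<in> topspace (cube (Suc d))"
  using cube_coord[OF assms(1), of D] by (intro cube_update[OF assms(2)]) auto

lemma unhalve_coord:
  assumes "s \<in> topspace (cube D)" "k \<in> topspace (cube (Suc d))"
  shows "s(D := 2 * \<bar>k d\<bar> - pi) \<in> topspace (cube (Suc D))"
proof -
  have "\<bar>k d\<bar> \<le> pi" using cube_coord[OF assms(2), of d] by linarith
  then show ?thesis by (intro cube_update[OF assms(1)]) linarith+
qed

text \<open>After uncurrying, halving is precomposition with a continuous map of cubes. The
  parameter \<open>z\<close> will be the time of a homotopy.\<close>

lemma continuous_map_halve:
  assumes "continuous_map (prod_topology Z (cube D)) (loop_space (Suc d) X x0) (\<lambda>(z, s). h z s)"
  shows "continuous_map (prod_topology Z (cube (Suc D))) (loop_space d X x0) (\<lambda>(z, s). halve D d (h z) s)"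
  unfolding continuous_map_into_loop_space
proof (intro conjI ballI)
  show "(\<lambda>(z, s). halve D d (h z) s)
      \<in> topspace (prod_topology Z (cube (Suc D))) \<rightarrow> extensional (topspace (cube d))"
    by (auto simp: halve_def)
next
  let ?P = "prod_topology (prod_topology Z (cube (Suc D))) (cube d)"
  have h: "continuous_map (prod_topology (prod_topology Z (cube D)) (cube (Suc d))) X
      (\<lambda>(w, k). (\<lambda>(z, s). h z s) w k)"
    using assms unfolding continuous_map_into_loop_space by blast
  have z: "continuous_map ?P Z (\<lambda>p. fst (fst p))"
    using continuous_map_compose[OF continuous_map_fst continuous_map_fst] by (simp add: o_def)
  have s: "continuous_map ?P (cube (Suc D)) (\<lambda>p. snd (fst p))"
    using continuous_map_compose[OF continuous_map_fst continuous_map_snd] by (simp add: o_def)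
  have u: "continuous_map ?P euclideanreal (\<lambda>p. (snd (fst p) D + pi) / 2)"
    using continuous_map_cube_coord[OF s lessI] by (intro continuous_intros) auto
  have "continuous_map ?P (cube (Suc d)) (\<lambda>p. (snd p)(d := (snd (fst p) D + pi) / 2))"
  proof (rule continuous_map_cube_update[OF continuous_map_snd u])
    fix p assume "p \<in> topspace ?P"
    then have "snd (fst p) \<in> topspace (cube (Suc D))" by auto
    from cube_coord[OF this lessI]
    show "-pi \<le> (snd (fst p) D + pi) / 2 \<and> (snd (fst p) D + pi) / 2 \<le> pi"
      using pi_gt_zero by (simp add: field_simps)
  qed simp
  then have "continuous_map ?P (prod_topology (prod_topology Z (cube D)) (cube (Suc d)))
      (\<lambda>p. ((fst (fst p), restrict (snd (fst p)) {..<D}), (snd p)(d := (snd (fst p) D + pi) / 2)))"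
    using z continuous_map_cube_restrict[OF s] by (intro continuous_map_pairedI)
  from continuous_map_compose[OF this h]
  show "continuous_map ?P X (\<lambda>(w, k). (\<lambda>(z, s). halve D d (h z) s) w k)"
    by (rule continuous_map_eq) (auto simp: halve_def)
next
  fix w k assume w: "w \<in> topspace (prod_topology Z (cube (Suc D)))" and k: "k \<in> cube_boundary d"
  obtain z s where ws: "w = (z, s)" by fastforce
  have s: "s \<in> topspace (cube (Suc D))" and z: "z \<in> topspace Z" using w ws by auto
  obtain i where i: "i < d" "k i = -pi \<or> k i = pi" and kc: "k \<in> topspace (cube d)"
    using k unfolding cube_boundary_def by blast
  have "k(d := (s D + pi) / 2) \<in> cube_boundary (Suc d)"
    unfolding cube_boundary_def using halve_coord[OF s kc] i by (auto intro!: exI[of _ i])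
  moreover have "(z, restrict s {..<D}) \<in> topspace (prod_topology Z (cube D))"
    using z cube_restrict[OF s] by simp
  ultimately have "h z (restrict s {..<D}) (k(d := (s D + pi) / 2)) = x0"
    using assms unfolding continuous_map_into_loop_space by fastforce
  then show "(case w of (z, s) \<Rightarrow> halve D d (h z) s) k = x0"
    using s kc by (simp add: ws halve_def)
qed

locale Z2_pointed =
  fixes X :: "'a topology" and g :: "'a \<Rightarrow> 'a" and x0 :: 'a
  assumes Z2_space: "Z2_space X g" and x0_fixed: "x0 \<in> Z2_fixed X g"
begin

lemma g_x0: "g x0 = x0"
  using x0_fixed by (simp add: Z2_fixed_def)

lemma x0_in: "x0 \<in> topspace X"
  using x0_fixed by (simp add: Z2_fixed_def)

lemma g_g: "x \<in> topspace X \<Longrightarrow> g (g x) = x"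
  using Z2_space by (simp add: Z2_space_def)

lemma continuous_map_g: "continuous_map X X g"
  using Z2_space by (simp add: Z2_space_def)

section \<open>Halves of equivariant loops satisfy the relative boundary condition\<close>

lemma cube_const_in_loop_fixed: "cube_const d x0 \<in> loop_fixed d X g x0"
  unfolding loop_fixed_iff mem_loop_space cmaps_def
proof (intro conjI ballI CollectI)
  show "continuous_map (cube d) X (cube_const d x0)"
    using cube_const_closed(1)[OF x0_in] by (simp add: cmaps_def)
next
  fix k assume "k \<in> topspace (cube d)"
  then show "g (cube_const d x0 (cube_neg d k)) = cube_const d x0 k"
    using cube_neg_in by (simp add: cube_const_def g_x0)
qed (auto simp: cube_const_def cube_boundary_def)

text \<open>The two pieces of \<open>cube_J\<close> give \<open>x0\<close> for different reasons. On
  the sides the whole loop being halved is constant; on the face \<open>s D = pi\<close> an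
  arbitrary loop is evaluated on the boundary of its cube.\<close>

lemma halve_eq_const:
  assumes f: "\<And>s. s \<in> topspace (cube D) \<Longrightarrow> f s \<in> loop_fixed (Suc d) X g x0"
    and abs: "abs_cond D (cube_const (Suc d) x0) f" and s: "s \<in> cube_J (Suc D)"
  shows "halve D d f s = cube_const d x0"
proof -
  have sc: "s \<in> topspace (cube (Suc D))" using s by (simp add: cube_J_def)
  have "f (restrict s {..<D}) (k(d := (s D + pi) / 2)) = x0" if k: "k \<in> topspace (cube d)" for k
  proof -
    have kc: "k(d := (s D + pi) / 2) \<in> topspace (cube (Suc d))" using sc k by (rule halve_coord)
    consider i where "i < D" "s i = -pi \<or> s i = pi" | "s D = pi"
      using s unfolding cube_J_def by auto
    then show ?thesis
    proof cases
      case 1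
      then have "restrict s {..<D} \<in> cube_boundary D"
        using cube_restrict[OF sc] by (auto simp: cube_boundary_def)
      then have "f (restrict s {..<D}) = cube_const (Suc d) x0"
        using abs by (simp add: abs_cond_def)
      then show ?thesis using kc by (simp add: cube_const_def)
    next
      case 2
      then have "k(d := (s D + pi) / 2) \<in> cube_boundary (Suc d)"
        using kc by (auto simp: cube_boundary_def)
      then show ?thesis
        using f[OF cube_restrict[OF sc]] by (simp add: loop_fixed_iff mem_loop_space)
    qed
  qed
  then show ?thesis using sc by (auto simp: halve_def cube_const_def restrict_def)
qed

text \<open>A boundary point outside \<open>cube_J\<close> has last coordinate -pi. There the halved
  loop is the restriction to the slice \<open>k d = 0\<close>, which negation maps to itself, so it
  inherits equivariance.\<close>

lemma rel_cond_halve: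
  assumes f: "\<And>s. s \<in> topspace (cube D) \<Longrightarrow> f s \<in> loop_fixed (Suc d) X g x0"
    and abs: "abs_cond D (cube_const (Suc d) x0) f"
    and in_loops: "\<And>s. s \<in> topspace (cube (Suc D)) \<Longrightarrow> halve D d f s \<in> topspace (loop_space d X x0)"
  shows "rel_cond (Suc D) (loop_fixed d X g x0) (cube_const d x0) (halve D d f)"
  unfolding rel_cond_def
proof (intro conjI ballI)
  fix s assume "s \<in> cube_J (Suc D)"
  then show "halve D d f s = cube_const d x0"
    using halve_eq_const[OF f abs] by blast
next
  fix s assume s: "s \<in> cube_boundary (Suc D)"
  show "halve D d f s \<in> loop_fixed d X g x0"
  proof (cases "s \<in> cube_J (Suc D)")
    case True
    then show ?thesis using halve_eq_const[OF f abs] cube_const_in_loop_fixed by simp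
  next
    case False
    have sc: "s \<in> topspace (cube (Suc D))" using s by (simp add: cube_boundary_def)
    have "s D = -pi"
      using s False by (auto simp: cube_boundary_def cube_J_def less_Suc_eq)
    then have u: "(s D + pi) / 2 = 0" by simp
    have "g (f (restrict s {..<D}) ((cube_neg d k)(d := 0))) = f (restrict s {..<D}) (k(d := 0))"
      if k: "k \<in> topspace (cube d)" for k
    proof -
      have "k(d := 0) \<in> topspace (cube (Suc d))" using halve_coord[OF sc k] u by simp
      moreover have "cube_neg (Suc d) (k(d := 0)) = (cube_neg d k)(d := 0)"
        by (auto simp: cube_neg_def fun_eq_iff restrict_def)
      ultimately show ?thesis
        using f[OF cube_restrict[OF sc]] by (metis loop_fixed_iff)
    qed
    then show ?thesis
      unfolding loop_fixed_iff using in_loops[OF sc] sc cube_neg_in u by (simp add: halve_def)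
  qed
qed

section \<open>The equivariant extension of a relative map\<close>

context
  fixes D d :: nat and G :: "(nat \<Rightarrow> real) \<Rightarrow> (nat \<Rightarrow> real) \<Rightarrow> 'a"
  assumes G: "\<And>s. s \<in> topspace (cube (Suc D)) \<Longrightarrow> G s \<in> topspace (loop_space d X x0)"
    and rel: "rel_cond (Suc D) (loop_fixed d X g x0) (cube_const d x0) G"
begin

lemma G_J:
  assumes "s \<in> cube_J (Suc D)" "k \<in> topspace (cube d)"
  shows "G s k = x0"
  using rel assms by (simp add: rel_cond_def cube_const_def)

lemma G_in:
  assumes "s \<in> topspace (cube (Suc D))" "k \<in> topspace (cube d)"
  shows "G s k \<in> topspace X"
  using G[OF assms(1)] assms(2) unfolding mem_loop_space cmaps_def
  by (auto dest: continuous_map_funspace)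

text \<open>A face of the last coordinate has |k d| = pi and so lands in \<open>cube_J\<close>,
  where \<open>G\<close> is constant. Any other face survives both dropping the last coordinate and
  negation, and there every loop takes the value \<open>x0\<close>, which g fixes.\<close>

lemma unhalve_boundary:
  assumes s: "s \<in> topspace (cube D)" and k: "k \<in> cube_boundary (Suc d)"
  shows "unhalve g D d G s k = x0"
proof -
  have kc: "k \<in> topspace (cube (Suc d))" using k by (simp add: cube_boundary_def)
  let ?s = "s(D := 2 * \<bar>k d\<bar> - pi)"
  have sc: "?s \<in> topspace (cube (Suc D))" using unhalve_coord[OF s kc] .
  have rk: "restrict k {..<d} \<in> topspace (cube d)" and nk: "cube_neg d k \<in> topspace (cube d)"
    using kc by (auto intro: cube_restrict cube_neg_in_Suc)
  obtain i where i: "i < Suc d" "k i = -pi \<or> k i = pi"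
    using k by (auto simp: cube_boundary_def)
  have "G ?s (restrict k {..<d}) = x0 \<and> G ?s (cube_neg d k) = x0"
  proof (cases "i = d")
    case True
    then have "\<bar>k d\<bar> = pi" using i by auto
    then have "?s \<in> cube_J (Suc D)" using sc by (simp add: cube_J_def)
    then show ?thesis using G_J rk nk by blast
  next
    case False
    then have "restrict k {..<d} \<in> cube_boundary d" "cube_neg d k \<in> cube_boundary d"
      using i rk nk by (auto simp: cube_boundary_def cube_neg_def intro!: exI[of _ i])
    then show ?thesis using G[OF sc] by (simp add: mem_loop_space)
  qed
  then show ?thesis using s kc by (simp add: unhalve_def g_x0 del: abs_of_nonneg abs_of_nonpos)
qed

text \<open>The points k and -k have the same |k d|, so \<open>G\<close> is evaluated at the same
  \<open>s\<close>. If \<open>k d\<close> is nonzero, exactly one of them lies in the negative half,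
  and the definition or g (g x) = x gives the claim. If \<open>k d = 0\<close>, both fall into the
  first branch, and the loop on the face \<open>s D = -pi\<close> has to be equivariant
  itself.\<close>

lemma unhalve_equivariant:
  assumes s: "s \<in> topspace (cube D)" and k: "k \<in> topspace (cube (Suc d))"
  shows "g (unhalve g D d G s (cube_neg (Suc d) k)) = unhalve g D d G s k"
proof -
  let ?s = "s(D := 2 * \<bar>k d\<bar> - pi)"
  have sc: "?s \<in> topspace (cube (Suc D))" using unhalve_coord[OF s k] .
  have rk: "restrict k {..<d} \<in> topspace (cube d)" using k by (rule cube_restrict)
  have neg: "cube_neg (Suc d) k d = - k d"
    "cube_neg d (cube_neg (Suc d) k) = restrict k {..<d}"
    "restrict (cube_neg (Suc d) k) {..<d} = cube_neg d k"
    "cube_neg d (restrict k {..<d}) = cube_neg d k"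
    by (auto simp: cube_neg_def fun_eq_iff restrict_def)
  have mid: "g (G ?s (cube_neg d k)) = G ?s (restrict k {..<d})" if "k d = 0"
  proof -
    have "?s \<in> cube_boundary (Suc D)" using sc that by (simp add: cube_boundary_def) blast
    then have "G ?s \<in> loop_fixed d X g x0" using rel by (simp add: rel_cond_def)
    then show ?thesis using rk neg(4) by (metis loop_fixed_iff)
  qed
  have gg: "g (g (G ?s (restrict k {..<d}))) = G ?s (restrict k {..<d})"
    using g_g[OF G_in[OF sc rk]] .
  show ?thesis
  proof (cases "k d = 0")
    case True
    then show ?thesis using s k cube_neg_in[OF k] mid by (simp add: unhalve_def neg)
  next
    case False
    then show ?thesis
      using s k cube_neg_in[OF k] gg
      by (simp add: unhalve_def neg del: abs_of_nonneg abs_of_nonpos)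
  qed
qed

lemma unhalve_eq_const:
  assumes s: "s \<in> cube_boundary D"
  shows "unhalve g D d G s = cube_const (Suc d) x0"
proof -
  have sc: "s \<in> topspace (cube D)" using s by (simp add: cube_boundary_def)
  have "G (s(D := 2 * \<bar>k d\<bar> - pi)) (restrict k {..<d}) = x0 \<and>
      G (s(D := 2 * \<bar>k d\<bar> - pi)) (cube_neg d k) = x0" if k: "k \<in> topspace (cube (Suc d))" for k
  proof -
    obtain i where "i < D" "s i = -pi \<or> s i = pi" using s by (auto simp: cube_boundary_def)
    then have "s(D := 2 * \<bar>k d\<bar> - pi) \<in> cube_J (Suc D)"
      using unhalve_coord[OF sc k] by (auto simp: cube_J_def intro!: exI[of _ i])
    then show ?thesis using G_J cube_restrict[OF k] cube_neg_in_Suc[OF k] by blast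
  qed
  then show ?thesis
    unfolding unhalve_def cube_const_def restrict_apply'[OF sc]
    by (intro restrict_ext) (simp add: g_x0 del: abs_of_nonneg abs_of_nonpos)
qed

lemma halve_unhalve:
  assumes s: "s \<in> topspace (cube (Suc D))"
  shows "halve D d (unhalve g D d G) s = G s"
proof
  fix k
  show "halve D d (unhalve g D d G) s k = G s k"
  proof (cases "k \<in> topspace (cube d)")
    case True
    \<comment> \<open>Halving evaluates only on the nonnegative half, so the branch involving g is
      never reached.\<close>
    have "0 \<le> (s D + pi) / 2" using cube_coord[OF s lessI] by simp
    then have "halve D d (unhalve g D d G) s k =
        G ((restrict s {..<D})(D := 2 * \<bar>(s D + pi) / 2\<bar> - pi)) (restrict (k(d := (s D + pi) / 2)) {..<d})"
      using s True cube_restrict[OF s] halve_coord[OF s True] by (simp add: halve_def unhalve_def)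
    moreover have "2 * \<bar>(s D + pi) / 2\<bar> - pi = s D"
      using \<open>0 \<le> (s D + pi) / 2\<close> by (simp add: field_simps)
    moreover have "(restrict s {..<D})(D := s D) = s"
      using s by (auto simp: fun_eq_iff restrict_def topspace_cube PiE_iff extensional_def)
    moreover have "restrict (k(d := (s D + pi) / 2)) {..<d} = k"
      using True by (auto simp: fun_eq_iff restrict_def topspace_cube PiE_iff extensional_def)
    ultimately show ?thesis by presburger
  next
    case False
    then show ?thesis
      using s G[OF s] by (simp add: halve_def mem_loop_space cmaps_def extensional_def)
  qed
qed

end

text \<open>On the nonnegative half the rescalings cancel; on the negative half the claim is the
  equivariance of \<open>f s\<close>.\<close>

lemma unhalve_halve:
  assumes f: "\<And>s. s \<in> topspace (cube D) \<Longrightarrow> f s \<in> loop_fixed (Suc d) X g x0"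
    and s: "s \<in> topspace (cube D)"
  shows "unhalve g D d (halve D d f) s = f s"
proof
  fix k
  show "unhalve g D d (halve D d f) s k = f s k"
  proof (cases "k \<in> topspace (cube (Suc d))")
    case True
    let ?s = "s(D := 2 * \<bar>k d\<bar> - pi)"
    have sc: "?s \<in> topspace (cube (Suc D))" using unhalve_coord[OF s True] .
    have rs: "restrict ?s {..<D} = s"
      using s by (auto simp: fun_eq_iff restrict_def topspace_cube PiE_iff extensional_def)
    have k1: "(restrict k {..<d})(d := k d) = k"
      using True by (auto simp: fun_eq_iff restrict_def topspace_cube PiE_iff extensional_def)
    have k2: "(cube_neg d k)(d := - k d) = cube_neg (Suc d) k"
      by (auto simp: fun_eq_iff cube_neg_def restrict_def)
    have "g (f s (cube_neg (Suc d) k)) = f s k"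
      using f[OF s] True by (simp add: loop_fixed_iff)
    then show ?thesis
      using s True sc rs k1 k2 cube_restrict[OF True] cube_neg_in_Suc[OF True]
      by (cases "0 \<le> k d") (simp_all add: halve_def unhalve_def)
  next
    case False
    then show ?thesis
      using s f[OF s]
      by (simp add: unhalve_def loop_fixed_iff mem_loop_space cmaps_def extensional_def)
  qed
qed

text \<open>Both branches are continuous on the whole product, and they are glued along
  \<open>k d = 0\<close>. The relative condition is required at every \<open>z\<close>, since it is
  what makes them agree there.\<close>

lemma continuous_map_unhalve:
  assumes G: "continuous_map (prod_topology Z (cube (Suc D))) (loop_space d X x0) (\<lambda>(z, s). G z s)"
    and rel: "\<And>z. z \<in> topspace Z \<Longrightarrow> rel_cond (Suc D) (loop_fixed d X g x0) (cube_const d x0) (G z)"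
  shows "continuous_map (prod_topology Z (cube D)) (loop_fixed_space (Suc d) X g x0)
    (\<lambda>(z, s). unhalve g D d (G z) s)"
proof -
  have Gin: "G z s \<in> topspace (loop_space d X x0)"
    if "z \<in> topspace Z" "s \<in> topspace (cube (Suc D))" for z s
    using Pi_mem[OF continuous_map_funspace[OF G], of "(z, s)"] that by simp
  let ?U = "\<lambda>(z, s). unhalve g D d (G z) s"
  let ?P = "prod_topology (prod_topology Z (cube D)) (cube (Suc d))"
  have U: "continuous_map (prod_topology Z (cube D)) (loop_space (Suc d) X x0) ?U"
    unfolding continuous_map_into_loop_space
  proof (intro conjI ballI)
    show "?U \<in> topspace (prod_topology Z (cube D)) \<rightarrow> extensional (topspace (cube (Suc d)))"
      by (auto simp: unhalve_def)
  next
    fix w k assume "w \<in> topspace (prod_topology Z (cube D))" and k: "k \<in> cube_boundary (Suc d)"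
    then obtain z s where "w = (z, s)" "z \<in> topspace Z" "s \<in> topspace (cube D)" by auto
    then show "?U w k = x0"
      using unhalve_boundary[OF Gin rel _ k] by simp
  next
    let ?t = "\<lambda>p. 2 * \<bar>snd p d\<bar> - pi"
    let ?w = "\<lambda>p. (fst (fst p), (snd (fst p))(D := ?t p))"
    have G': "continuous_map (prod_topology (prod_topology Z (cube (Suc D))) (cube d)) X
        (\<lambda>(w, k). (\<lambda>(z, s). G z s) w k)"
      using G unfolding continuous_map_into_loop_space by blast
    have z: "continuous_map ?P Z (\<lambda>p. fst (fst p))"
      using continuous_map_compose[OF continuous_map_fst continuous_map_fst] by (simp add: o_def)
    have s: "continuous_map ?P (cube D) (\<lambda>p. snd (fst p))"
      using continuous_map_compose[OF continuous_map_fst continuous_map_snd] by (simp add: o_def)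
    have k: "continuous_map ?P (cube (Suc d)) snd" by (rule continuous_map_snd)
    have kd: "continuous_map ?P euclideanreal (\<lambda>p. snd p d)"
      using continuous_map_cube_coord[OF k lessI] .
    have t: "continuous_map ?P euclideanreal ?t"
      using kd by (intro continuous_intros) auto
    have "continuous_map ?P (cube (Suc D)) (\<lambda>p. (snd (fst p))(D := ?t p))"
    proof (rule continuous_map_cube_update[OF s t])
      fix p assume "p \<in> topspace ?P"
      then have "snd p \<in> topspace (cube (Suc d))" by auto
      from cube_coord[OF this lessI] show "-pi \<le> ?t p \<and> ?t p \<le> pi" by linarith
    qed simp
    then have w: "continuous_map ?P (prod_topology Z (cube (Suc D))) ?w"
      using z by (intro continuous_map_pairedI)
    have c1: "continuous_map ?P X (\<lambda>p. G (fst (fst p)) ((snd (fst p))(D := ?t p)) (restrict (snd p) {..<d}))"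
      using continuous_map_compose[OF continuous_map_pairedI[OF w continuous_map_cube_restrict[OF k]] G']
      by (simp add: o_def)
    have "continuous_map ?P X (\<lambda>p. G (fst (fst p)) ((snd (fst p))(D := ?t p)) (cube_neg d (snd p)))"
      using continuous_map_compose[OF continuous_map_pairedI[OF w continuous_map_cube_neg[OF k]] G']
      by (simp add: o_def)
    from continuous_map_compose[OF this continuous_map_g]
    have c2: "continuous_map ?P X
        (\<lambda>p. g (G (fst (fst p)) ((snd (fst p))(D := ?t p)) (cube_neg d (snd p))))"
      by (simp add: o_def)
    have "continuous_map ?P X (\<lambda>p. if 0 \<le> snd p d
        then G (fst (fst p)) ((snd (fst p))(D := ?t p)) (restrict (snd p) {..<d})
        else g (G (fst (fst p)) ((snd (fst p))(D := ?t p)) (cube_neg d (snd p))))"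
    proof (rule continuous_map_cases_le)
      fix p assume p: "p \<in> topspace ?P" and 0: "0 = snd p d"
      let ?s = "(snd (fst p))(D := ?t p)"
      have zp: "fst (fst p) \<in> topspace Z" and sp: "snd (fst p) \<in> topspace (cube D)"
        and kp: "snd p \<in> topspace (cube (Suc d))" using p by auto
      \<comment> \<open>For \<open>k d = 0\<close> the new last coordinate is -pi, so the loop lies
        in the fixed set and the two formulas coincide.\<close>
      have "?s \<in> cube_boundary (Suc D)"
        using unhalve_coord[OF sp kp] 0 by (auto simp: cube_boundary_def)
      then have "G (fst (fst p)) ?s \<in> loop_fixed d X g x0"
        using rel[OF zp] by (simp add: rel_cond_def)
      then have "g (G (fst (fst p)) ?s (cube_neg d (restrict (snd p) {..<d})))
          = G (fst (fst p)) ?s (restrict (snd p) {..<d})"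
        using cube_restrict[OF kp] unfolding loop_fixed_iff by blast
      moreover have "cube_neg d (restrict (snd p) {..<d}) = cube_neg d (snd p)"
        by (auto simp: cube_neg_def fun_eq_iff restrict_def)
      ultimately show "G (fst (fst p)) ?s (restrict (snd p) {..<d})
          = g (G (fst (fst p)) ?s (cube_neg d (snd p)))"
        by simp
    qed (use kd c1 c2 in \<open>simp_all add: continuous_map_from_subtopology\<close>)
    then show "continuous_map ?P X (\<lambda>(w, k). ?U w k)"
      by (rule continuous_map_eq) (auto simp: unhalve_def)
  qed
  show ?thesis
    unfolding loop_fixed_space_def
  proof (rule continuous_map_into_subtopology[OF U], rule funcsetI)
    fix w assume "w \<in> topspace (prod_topology Z (cube D))"
    then obtain z s where w: "w = (z, s)" "z \<in> topspace Z" "s \<in> topspace (cube D)" by auto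
    have "?U w \<in> topspace (loop_space (Suc d) X x0)"
      using Pi_mem[OF continuous_map_funspace[OF U], of w] w by simp
    then show "?U w \<in> loop_fixed (Suc d) X g x0"
      unfolding loop_fixed_iff
      using unhalve_equivariant[OF Gin rel] w by simp
  qed
qed

end


section \<open>The isomorphism\<close>

context Z2_pointed
begin

section \<open>Halving on homotopies and on homotopy classes\<close>

abbreviation loops_cond :: "nat \<Rightarrow> nat \<Rightarrow> ((nat \<Rightarrow> real) \<Rightarrow> (nat \<Rightarrow> real) \<Rightarrow> 'a) \<Rightarrow> bool" where
  "loops_cond D d \<equiv> abs_cond D (cube_const (Suc d) x0)"

abbreviation halves_cond :: "nat \<Rightarrow> nat \<Rightarrow> ((nat \<Rightarrow> real) \<Rightarrow> (nat \<Rightarrow> real) \<Rightarrow> 'a) \<Rightarrow> bool" where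
  "halves_cond D d \<equiv> rel_cond (Suc D) (loop_fixed d X g x0) (cube_const d x0)"

abbreviation loops_homotopy where
  "loops_homotopy D d \<equiv> cube_homotopy (loops_cond D d) D (loop_fixed_space (Suc d) X g x0)"

abbreviation halves_homotopy where
  "halves_homotopy D d \<equiv> cube_homotopy (halves_cond D d) (Suc D) (loop_space d X x0)"

lemma halve_homotopic:
  assumes "(f, f') \<in> loops_homotopy D d"
  shows "(halve D d f, halve D d f') \<in> halves_homotopy D d"
proof -
  let ?I = "top_of_set {0..1::real}"
  obtain H where H: "continuous_map (prod_topology ?I (cube D)) (loop_fixed_space (Suc d) X g x0) (\<lambda>(t, s). H t s)"
      "\<forall>s\<in>topspace (cube D). H 0 s = f s \<and> H 1 s = f' s" "\<forall>t\<in>{0..1}. loops_cond D d (H t)"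
    using assms unfolding cube_homotopy_iff[OF cube_cond_local_abs_cond] by blast
  have fixed: "H t s \<in> loop_fixed (Suc d) X g x0" if "t \<in> {0..1}" "s \<in> topspace (cube D)" for t s
    using Pi_mem[OF continuous_map_funspace[OF H(1)], of "(t, s)"] that
    by (simp add: topspace_loop_fixed_space)
  have "continuous_map (prod_topology ?I (cube D)) (loop_space (Suc d) X x0) (\<lambda>(t, s). H t s)"
    using H(1) unfolding loop_fixed_space_def by (rule continuous_map_into_fulltopology)
  then have K: "continuous_map (prod_topology ?I (cube (Suc D))) (loop_space d X x0)
      (\<lambda>(t, s). halve D d (H t) s)"
    by (rule continuous_map_halve)
  have "halves_cond D d (halve D d (H t))" if t: "t \<in> {0..1}" for t
  proof (rule rel_cond_halve)
    show "halve D d (H t) s \<in> topspace (loop_space d X x0)" if "s \<in> topspace (cube (Suc D))" for s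
      using Pi_mem[OF continuous_map_funspace[OF K], of "(t, s)"] that t by simp
  qed (use H(3) fixed t in auto)
  \<comment> \<open>\<open>H 0\<close> and \<open>f\<close> may differ off the cube, but halving
    reads its argument only at points of the cube, so the halves are equal as functions.\<close>
  moreover have "halve D d (H 0) = halve D d f" "halve D d (H 1) = halve D d f'"
    using H(2) cube_restrict unfolding halve_def by (auto intro!: restrict_ext)
  ultimately show ?thesis
    unfolding cube_homotopy_iff[OF cube_cond_local_rel_cond]
  proof (intro conjI exI[of _ "\<lambda>t. halve D d (H t)"])
    show "halve D d f \<in> extensional (topspace (cube (Suc D)))" "halve D d f' \<in> extensional (topspace (cube (Suc D)))"
      by (simp_all add: halve_def)
  qed (use K in auto)
qed

lemma unhalve_homotopic:
  assumes "(G, G') \<in> halves_homotopy D d"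
  shows "(unhalve g D d G, unhalve g D d G') \<in> loops_homotopy D d"
proof -
  let ?I = "top_of_set {0..1::real}"
  obtain H where H: "continuous_map (prod_topology ?I (cube (Suc D))) (loop_space d X x0) (\<lambda>(t, s). H t s)"
      "\<forall>s\<in>topspace (cube (Suc D)). H 0 s = G s \<and> H 1 s = G' s" "\<forall>t\<in>{0..1}. halves_cond D d (H t)"
    using assms unfolding cube_homotopy_iff[OF cube_cond_local_rel_cond] by blast
  have Hin: "H t s \<in> topspace (loop_space d X x0)" if "t \<in> {0..1}" "s \<in> topspace (cube (Suc D))" for t s
    using Pi_mem[OF continuous_map_funspace[OF H(1)], of "(t, s)"] that by simp
  have K: "continuous_map (prod_topology ?I (cube D)) (loop_fixed_space (Suc d) X g x0)
      (\<lambda>(t, s). unhalve g D d (H t) s)"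
    using H by (intro continuous_map_unhalve) auto
  have "loops_cond D d (unhalve g D d (H t))" if "t \<in> {0..1}" for t
    unfolding abs_cond_def using unhalve_eq_const[where D = D and d = d and G = "H t"] H(3) Hin that by blast
  moreover have "unhalve g D d (H 0) = unhalve g D d G" "unhalve g D d (H 1) = unhalve g D d G'"
    using H(2) unhalve_coord unfolding unhalve_def
    by (auto intro!: restrict_ext simp del: abs_of_nonneg abs_of_nonpos)
  ultimately show ?thesis
    unfolding cube_homotopy_iff[OF cube_cond_local_abs_cond]
  proof (intro conjI exI[of _ "\<lambda>t. unhalve g D d (H t)"])
    show "unhalve g D d G \<in> extensional (topspace (cube D))" "unhalve g D d G' \<in> extensional (topspace (cube D))"
      by (simp_all add: unhalve_def)
  qed (use K in auto)
qed

abbreviation loops_maps where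
  "loops_maps D d \<equiv> {f \<in> cmaps (cube D) (loop_fixed_space (Suc d) X g x0). loops_cond D d f}"

abbreviation halves_maps where
  "halves_maps D d \<equiv> {G \<in> cmaps (cube (Suc D)) (loop_space d X x0). halves_cond D d G}"

lemma unhalve_halve_map:
  assumes "f \<in> loops_maps D d" shows "unhalve g D d (halve D d f) = f"
proof -
  have f: "f \<in> extensional (topspace (cube D))"
    "continuous_map (cube D) (loop_fixed_space (Suc d) X g x0) f"
    using assms by (auto simp: cmaps_def)
  have "f s \<in> loop_fixed (Suc d) X g x0" if "s \<in> topspace (cube D)" for s
    using Pi_mem[OF continuous_map_funspace[OF f(2)] that] by (simp add: topspace_loop_fixed_space)
  then show ?thesis
    by (intro extensionalityI[OF _ f(1)] unhalve_halve) (auto simp: unhalve_def)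
qed

lemma halve_unhalve_map:
  assumes "G \<in> halves_maps D d" shows "halve D d (unhalve g D d G) = G"
proof -
  have G: "G \<in> extensional (topspace (cube (Suc D)))"
    "continuous_map (cube (Suc D)) (loop_space d X x0) G" "halves_cond D d G"
    using assms by (auto simp: cmaps_def)
  have "G s \<in> topspace (loop_space d X x0)" if "s \<in> topspace (cube (Suc D))" for s
    using Pi_mem[OF continuous_map_funspace[OF G(2)] that] .
  then show ?thesis
    by (intro extensionalityI[OF _ G(1)] halve_unhalve G(3)) (auto simp: halve_def)
qed

text \<open>A map is homotopic to itself, and the preservation of homotopies includes that their
  ends are admissible maps.\<close>

lemma halve_in: "f \<in> loops_maps D d \<Longrightarrow> halve D d f \<in> halves_maps D d"
  using cube_homotopy_memD(1,2)[OF halve_homotopic[OF cube_homotopy_refl]] by blast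

lemma unhalve_in: "G \<in> halves_maps D d \<Longrightarrow> unhalve g D d G \<in> loops_maps D d"
  using cube_homotopy_memD(1,2)[OF unhalve_homotopic[OF cube_homotopy_refl]] by blast

lemma bij_betw_halve: "bij_betw (halve D d) (loops_maps D d) (halves_maps D d)"
  by (rule bij_betw_byWitness[where f' = "unhalve g D d"])
    (use unhalve_halve_map halve_unhalve_map halve_in unhalve_in in blast)+

lemma halve_homotopic_iff:
  assumes "f \<in> loops_maps D d" "f' \<in> loops_maps D d"
  shows "(f, f') \<in> loops_homotopy D d \<longleftrightarrow> (halve D d f, halve D d f') \<in> halves_homotopy D d"
  using halve_homotopic unhalve_homotopic[of "halve D d f" "halve D d f'"]
    unhalve_halve_map[OF assms(1)] unhalve_halve_map[OF assms(2)] by metis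

lemma bij_betw_halve_classes:
  "bij_betw ((`) (halve D d)) (loops_maps D d // loops_homotopy D d)
    (halves_maps D d // halves_homotopy D d)"
  using halve_homotopic_iff
  by (rule bij_betw_quotient(1)[OF equiv_cube_homotopy equiv_cube_homotopy bij_betw_halve])

lemma halve_class:
  assumes "f \<in> loops_maps D d"
  shows "halve D d ` (loops_homotopy D d `` {f}) = halves_homotopy D d `` {halve D d f}"
  using halve_homotopic_iff assms
  by (rule bij_betw_quotient(2)[OF equiv_cube_homotopy equiv_cube_homotopy bij_betw_halve])

text \<open>Since D \<ge> 1, coordinate \<open>0\<close> is not the path coordinate
  \<open>D\<close>: changing it leaves \<open>s D\<close> alone and commutes with dropping
  coordinate \<open>D\<close>. Both concatenations rescale it by the same formula, hence an equality
  rather than a homotopy.\<close>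

lemma halve_concat:
  assumes "D \<ge> 1"
  shows "halve D d (cube_concat D f h) = cube_concat (Suc D) (halve D d f) (halve D d h)"
  unfolding halve_def[of D d "cube_concat D f h"] cube_concat_def[of "Suc D"]
proof (rule restrict_ext)
  fix s assume s: "s \<in> topspace (cube (Suc D))"
  let ?a = "2 * s 0 + pi" and ?b = "2 * s 0 - pi"
  have s0: "-pi \<le> s 0" "s 0 \<le> pi" using cube_coord[OF s, of 0] by auto
  have up: "(restrict s {..<D})(0 := u) = restrict (s(0 := u)) {..<D}" for u
    using assms by (auto simp: fun_eq_iff restrict_def)
  have a: "s(0 := ?a) \<in> topspace (cube (Suc D))" if "s 0 \<le> 0"
    using that s0 by (intro cube_update_0[OF s]) auto
  have b: "s(0 := ?b) \<in> topspace (cube (Suc D))" if "\<not> s 0 \<le> 0"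
    using that s0 by (intro cube_update_0[OF s]) auto
  show "(\<lambda>k\<in>topspace (cube d). cube_concat D f h (restrict s {..<D}) (k(d := (s D + pi) / 2)))
    = (if s 0 \<le> 0 then halve D d f (s(0 := ?a)) else halve D d h (s(0 := ?b)))"
  proof (cases "s 0 \<le> 0")
    case True
    have "cube_concat D f h (restrict s {..<D}) = f (restrict (s(0 := ?a)) {..<D})"
      using True assms cube_restrict[OF s] unfolding up[symmetric] by (simp add: cube_concat_def)
    then show ?thesis using True assms a[OF True] by (simp add: halve_def)
  next
    case False
    have "cube_concat D f h (restrict s {..<D}) = h (restrict (s(0 := ?b)) {..<D})"
      using False assms cube_restrict[OF s] unfolding up[symmetric] by (simp add: cube_concat_def)
    then show ?thesis using False assms b[OF False] by (simp add: halve_def)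
  qed
qed

lemma halve_const: "halve D d (cube_const D (cube_const (Suc d) x0)) = cube_const (Suc D) (cube_const d x0)"
  unfolding halve_def cube_const_def[of "Suc D"]
proof (rule restrict_ext)
  fix s assume s: "s \<in> topspace (cube (Suc D))"
  show "(\<lambda>k\<in>topspace (cube d). cube_const D (cube_const (Suc d) x0) (restrict s {..<D}) (k(d := (s D + pi) / 2)))
    = cube_const d x0"
    unfolding cube_const_def[of d]
    by (rule restrict_ext) (use halve_coord[OF s] cube_restrict[OF s] in \<open>simp add: cube_const_def\<close>)
qed

section \<open>The isomorphism of groups for D \<ge> 1\<close>

lemma const_in_loop_fixed_space: "cube_const (Suc d) x0 \<in> topspace (loop_fixed_space (Suc d) X g x0)"
  by (simp add: topspace_loop_fixed_space cube_const_in_loop_fixed)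

lemma halve_iso:
  assumes D: "D \<ge> 1"
  shows "(`) (halve D d) \<in> iso
    (homotopy_group D (loop_fixed_space (Suc d) X g x0) (cube_const (Suc d) x0))
    (rel_homotopy_group (Suc D) (loop_space d X x0) (loop_fixed d X g x0) (cube_const d x0))"
    (is "_ \<in> iso ?G ?H")
proof -
  let ?R = "loops_homotopy D d" and ?S = "halves_homotopy D d"
  have carG: "carrier ?G = loops_maps D d // ?R" and carH: "carrier ?H = halves_maps D d // ?S"
    by (simp_all add: homotopy_group_def rel_homotopy_group_def cube_group_def cube_classes_def)
  have bij: "bij_betw ((`) (halve D d)) (carrier ?G) (carrier ?H)"
    unfolding carG carH by (rule bij_betw_halve_classes)
  \<comment> \<open>Relative homotopies are extended equivariantly, concatenated on the absolute
    side and halved again; the round trip is the identity and commutes with concatenation.\<close>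
  have compat: "(cube_concat (Suc D) G K, cube_concat (Suc D) G' K') \<in> ?S"
    if GG: "(G, G') \<in> ?S" and KK: "(K, K') \<in> ?S" for G G' K K'
  proof -
    have "(halve D d (cube_concat D (unhalve g D d G) (unhalve g D d K)),
        halve D d (cube_concat D (unhalve g D d G') (unhalve g D d K'))) \<in> ?S"
      using GG KK by (intro halve_homotopic cube_concat_homotopic[OF D] unhalve_homotopic)
    then show ?thesis
      using cube_homotopy_memD[OF GG] cube_homotopy_memD[OF KK]
      by (simp add: halve_concat[OF D] halve_unhalve_map)
  qed
  have "halve D d ` (A \<otimes>\<^bsub>?G\<^esub> B) = halve D d ` A \<otimes>\<^bsub>?H\<^esub> halve D d ` B"
    if A: "A \<in> carrier ?G" and B: "B \<in> carrier ?G" for A B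
  proof -
    obtain f where f: "f \<in> loops_maps D d" "A = ?R `` {f}" using A unfolding carG by (rule quotientE)
    obtain h where h: "h \<in> loops_maps D d" "B = ?R `` {h}" using B unfolding carG by (rule quotientE)
    have fh: "cube_concat D f h \<in> loops_maps D d"
    proof -
      have "f \<in> cmaps (cube D) (loop_fixed_space (Suc d) X g x0)" "loops_cond D d f"
        "h \<in> cmaps (cube D) (loop_fixed_space (Suc d) X g x0)" "loops_cond D d h"
        using f(1) h(1) by simp_all
      from cube_concat_closed[OF D this] show ?thesis by simp
    qed
    have "A \<otimes>\<^bsub>?G\<^esub> B = ?R `` {cube_concat D f h}"
      unfolding f(2) h(2) homotopy_group_def
    proof (rule cube_mult_classes)
      show "(cube_concat D e k, cube_concat D e' k') \<in> ?R" if "(e, e') \<in> ?R" "(k, k') \<in> ?R" for e e' k k'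
        using D that by (rule cube_concat_homotopic)
    qed (use f(1) h(1) in simp_all)
    then have "halve D d ` (A \<otimes>\<^bsub>?G\<^esub> B) = ?S `` {cube_concat (Suc D) (halve D d f) (halve D d h)}"
      by (simp only: halve_class[OF fh] halve_concat[OF D])
    also have "\<dots> = ?S `` {halve D d f} \<otimes>\<^bsub>?H\<^esub> ?S `` {halve D d h}"
      unfolding rel_homotopy_group_def
    proof (rule cube_mult_classes[symmetric])
      show "(cube_concat (Suc D) G K, cube_concat (Suc D) G' K') \<in> ?S"
        if "(G, G') \<in> ?S" "(K, K') \<in> ?S" for G G' K K'
        using that by (rule compat)
    qed (use halve_in[OF f(1)] halve_in[OF h(1)] in simp_all)
    finally show ?thesis
      unfolding f(2) h(2) halve_class[OF f(1)] halve_class[OF h(1)] .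
  qed
  moreover have "(`) (halve D d) \<in> carrier ?G \<rightarrow> carrier ?H"
    using bij by (rule bij_betw_imp_funcset)
  ultimately show ?thesis using bij by (simp add: iso_def hom_def)
qed

lemma group_loops:
  assumes "D \<ge> 1"
  shows "group (homotopy_group D (loop_fixed_space (Suc d) X g x0) (cube_const (Suc d) x0))"
  using assms const_in_loop_fixed_space by (rule group_homotopy_group)

lemma group_halves:
  assumes D: "D \<ge> 1"
  shows "group (rel_homotopy_group (Suc D) (loop_space d X x0) (loop_fixed d X g x0) (cube_const d x0))"
    (is "group ?H")
proof -
  let ?G = "homotopy_group D (loop_fixed_space (Suc d) X g x0) (cube_const (Suc d) x0)"
  have "cube_const D (cube_const (Suc d) x0) \<in> loops_maps D d"
    using cube_const_closed[OF const_in_loop_fixed_space] by blast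
  from halve_class[OF this] have one: "halve D d ` \<one>\<^bsub>?G\<^esub> = \<one>\<^bsub>?H\<^esub>"
    by (simp add: homotopy_group_def rel_homotopy_group_def cube_group_def halve_const)
  \<comment> \<open>The image of a group under an isomorphism is a group whose unit is the image of
    the unit. By \<open>one\<close> this is the unit already built into \<open>?H\<close>, so the
    update changes nothing.\<close>
  have "group (?H\<lparr>one := \<one>\<^bsub>?H\<^esub>\<rparr>)"
    using group.iso_imp_img_group[OF group_loops[OF D] halve_iso[OF D, of d]] unfolding one .
  then show ?thesis by simp
qed

end

text \<open>This bridges the case D = 0, where one side is given by path components while halving
  acts on classes of cube maps. The 0-cube is a point with empty boundary, so the condition is
  vacuous and a homotopy is a path.\<close>

lemma bij_betw_path_components:
  "\<exists>\<phi>. bij_betw \<phi> (path_components_of Y) (cube_classes (abs_cond 0 y0) 0 Y)"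
proof -
  let ?A = "{(x, y). path_component_of Y x y}" and ?P = "abs_cond 0 y0 :: ((nat \<Rightarrow> real) \<Rightarrow> 'a) \<Rightarrow> bool"
  let ?e = "cube_const 0 :: 'a \<Rightarrow> (nat \<Rightarrow> real) \<Rightarrow> 'a" and ?p = "(\<lambda>_. undefined) :: nat \<Rightarrow> real"
  have P: "?P = (\<lambda>_. True)" by (simp add: abs_cond_def cube_boundary_def fun_eq_iff)
  have "equiv (topspace Y) ?A"
    by (rule equivI) (auto simp: refl_on_def sym_def trans_def path_component_of_refl
        dest: path_component_in_topspace path_component_of_sym path_component_of_trans)
  moreover have "bij_betw ?e (topspace Y) {f \<in> cmaps (cube 0) Y. ?P f}"
  proof (rule bij_betw_byWitness[where f' = "\<lambda>f. f ?p"])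
    show "\<forall>y\<in>topspace Y. ?e y ?p = y" by (simp add: cube_const_def topspace_cube_0)
    show "\<forall>f\<in>{f \<in> cmaps (cube 0) Y. ?P f}. ?e (f ?p) = f"
    proof
      fix f assume "f \<in> {f \<in> cmaps (cube 0) Y. ?P f}"
      then have "f \<in> extensional (topspace (cube 0))" by (simp add: cmaps_def)
      then show "?e (f ?p) = f"
        by (intro extensionalityI[where A = "topspace (cube 0)"]) (simp_all add: cube_const_def topspace_cube_0)
    qed
    show "?e ` topspace Y \<subseteq> {f \<in> cmaps (cube 0) Y. ?P f}"
      using cube_const_closed(1)[of _ Y 0] by (auto simp: P)
    show "(\<lambda>f. f ?p) ` {f \<in> cmaps (cube 0) Y. ?P f} \<subseteq> topspace Y"
      by (auto simp: cmaps_def topspace_cube_0 dest: continuous_map_funspace)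
  qed
  moreover have "(x, y) \<in> ?A \<longleftrightarrow> (?e x, ?e y) \<in> cube_homotopy ?P 0 Y"
    if "x \<in> topspace Y" "y \<in> topspace Y" for x y
  proof -
    \<comment> \<open>On an empty domain any two constant maps would be homotopic, so the comparison
      with paths needs the 0-cube to have a point.\<close>
    have "cube 0 \<noteq> trivial_topology"
      by (metis insert_not_empty topspace_cube_0 topspace_discrete_topology)
    then have "path_component_of Y x y \<longleftrightarrow> homotopic_with ?P (cube 0) Y (\<lambda>_. x) (\<lambda>_. y)"
      unfolding P homotopic_constant_maps by simp
    also have "\<dots> \<longleftrightarrow> homotopic_with ?P (cube 0) Y (?e x) (?e y)"
      by (intro iffI; erule homotopic_with_eq) (auto simp: cube_const_def P)
    finally show ?thesis
      using cube_const_closed(1)[of _ Y 0] that by (simp add: cube_homotopy_def)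
  qed
  ultimately have "bij_betw ((`) ?e) (topspace Y // ?A) ({f \<in> cmaps (cube 0) Y. ?P f} // cube_homotopy ?P 0 Y)"
    using equiv_cube_homotopy by (intro bij_betw_quotient)
  moreover have "path_components_of Y = topspace Y // ?A"
    unfolding path_components_of_def quotient_def by auto
  ultimately show ?thesis unfolding cube_classes_def by auto
qed

theorem mainTheorem1:
  fixes X :: "'a topology" and g :: "'a \<Rightarrow> 'a" and x0 :: 'a and D d :: nat
  assumes "Z2_space X g" and "x0 \<in> Z2_fixed X g"
  shows "(D = 0 \<longrightarrow>
            (\<exists>\<phi>. bij_betw \<phi> (path_components_of (loop_fixed_space (d + 1) X g x0))
                  (rel_homotopy_set (D + 1) (loop_space d X x0) (loop_fixed d X g x0) (cube_const d x0))))
       \<and> (D \<ge> 1 \<longrightarrow>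
            group (homotopy_group D (loop_fixed_space (d + 1) X g x0) (cube_const (d + 1) x0))
          \<and> group (rel_homotopy_group (D + 1) (loop_space d X x0) (loop_fixed d X g x0) (cube_const d x0))
          \<and> homotopy_group D (loop_fixed_space (d + 1) X g x0) (cube_const (d + 1) x0)
              \<cong> rel_homotopy_group (D + 1) (loop_space d X x0) (loop_fixed d X g x0) (cube_const d x0))"
proof -
  interpret Z2_pointed X g x0 using assms by unfold_locales
  have "\<exists>\<phi>. bij_betw \<phi> (path_components_of (loop_fixed_space (Suc d) X g x0))
      (rel_homotopy_set (Suc 0) (loop_space d X x0) (loop_fixed d X g x0) (cube_const d x0))"
  proof -
    obtain \<phi> where "bij_betw \<phi> (path_components_of (loop_fixed_space (Suc d) X g x0))
        (cube_classes (loops_cond 0 d) 0 (loop_fixed_space (Suc d) X g x0))"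
      using bij_betw_path_components ..
    moreover have "bij_betw ((`) (halve 0 d)) (cube_classes (loops_cond 0 d) 0 (loop_fixed_space (Suc d) X g x0))
        (rel_homotopy_set (Suc 0) (loop_space d X x0) (loop_fixed d X g x0) (cube_const d x0))"
      unfolding cube_classes_def rel_homotopy_set_def by (rule bij_betw_halve_classes)
    ultimately show ?thesis by (intro exI) (rule bij_betw_trans)
  qed
  moreover have "homotopy_group D (loop_fixed_space (Suc d) X g x0) (cube_const (Suc d) x0)
      \<cong> rel_homotopy_group (Suc D) (loop_space d X x0) (loop_fixed d X g x0) (cube_const d x0)" if "D \<ge> 1"
    using halve_iso[OF that] unfolding is_iso_def by blast
  ultimately show ?thesis
    using group_loops group_halves by simp
qed

end
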